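(* Let $V$ be a finite-dimensional vector space over a field $\mathbf{k}$ of characteristic zero. The bracket $[\cdot,\cdot]_{dL}$ defined by $$[P,Q]_{dL}:=P\,\square\, Q-(-1)^{pq}\,Q\,\square\, P,\qquad P\in\mathcal{C}^p_{dL}(V),\ Q\in\mathcal{C}^q_{dL}(V),$$ endows $\mathcal{C}^\bullet_{dL}(V)=\bigoplus_{p\ge 0}\mathcal{C}^p_{dL}(V)$ with the structure of a graded Lie algebra. Explicitly, for all $P\in\mathcal{C}^p_{dL}(V)$, $Q\in\mathcal{C}^q_{dL}(V)$ and $R\in\mathcal{C}^r_{dL}(V)$ with $p,q,r\geq 0$, $$[P,Q]_{dL}=-(-1)^{pq}[Q,P]_{dL},$$ $$[P,[Q,R]_{dL}]_{dL}=[[P,Q]_{dL},R]_{dL}+(-1)^{pq}[Q,[P,R]_{dL}]_{dL}.$$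
   Context: For $n\ge1$, $\sigma_n:V^{\otimes n}\to V^{\otimes n}$ is the cyclic permutation $\sigma_n(a_1\otimes\cdots\otimes a_n)=a_n\otimes a_1\otimes\cdots\otimes a_{n-1}$. For $p\ge0$, $\mathcal{C}^p_{dL}(V):=\{P\in\mathrm{End}(V^{\otimes(p+1)})\mid \sigma_{p+1}P\sigma_{p+1}^{-1}=(-1)^pP\}$; its elements have degree $p$, and $\mathcal{C}^\bullet_{dL}(V):=\bigoplus_{p\ge0}\mathcal{C}^p_{dL}(V)$. For $P\in\mathcal{C}^p_{dL}(V)$ and $Q\in\mathcal{C}^q_{dL}(V)$, put $P\diamond Q:=(P\otimes\mathrm{id}^{\otimes q})\circ(\mathrm{id}^{\otimes p}\otimes Q)\in\mathrm{End}(V^{\otimes(p+q+1)})$ and $$P\,\square\, Q:=\sum_{s=0}^{p+q}(-1)^{(p+q)s}\,\sigma_{p+q+1}^{s}\circ(P\diamond Q)\circ\sigma_{p+q+1}^{-s}.$$ *)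

theory Defs
  imports Complex_Main "HOL-Library.Function_Algebras"
begin

text \<open>
  Function types carry the pointwise additive structure of
  \<^theory>\<open>HOL-Library.Function_Algebras\<close>; the matching scalar multiplication is:
\<close>

definition fun_scale :: "('k \<Rightarrow> 'b \<Rightarrow> 'b) \<Rightarrow> 'k \<Rightarrow> ('a \<Rightarrow> 'b) \<Rightarrow> ('a \<Rightarrow> 'b)"
  where "fun_scale t c f = (\<lambda>x. t c (f x))"

lemma vector_space_fun_scale:
  assumes "vector_space t"
  shows "vector_space (fun_scale t)"
proof -
  interpret vector_space t by fact
  show ?thesis
    by unfold_locales (auto simp: fun_scale_def fun_eq_iff scale_right_distrib scale_left_distrib)
qed

lemma vector_space_field: "vector_space ((*) :: 'k::field \<Rightarrow> 'k \<Rightarrow> 'k)"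
  by unfold_locales (auto simp: algebra_simps)


section \<open>Tensor powers\<close>

definition multilinear ::
  "('k::field \<Rightarrow> 'v::ab_group_add \<Rightarrow> 'v) \<Rightarrow> ('k \<Rightarrow> 'w::ab_group_add \<Rightarrow> 'w) \<Rightarrow> nat \<Rightarrow> ('v list \<Rightarrow> 'w) \<Rightarrow> bool"
  where "multilinear s t n f \<longleftrightarrow>
    (\<forall>xs i. length xs = n \<longrightarrow> i < n \<longrightarrow> Vector_Spaces.linear s t (\<lambda>v. f (xs[i := v])))"

text \<open>
  The n-th tensor power of a vector space is realised inside the dual of the space of
  n-multilinear forms: \<open>a\<^sub>1 \<otimes> \<dots> \<otimes> a\<^sub>n\<close> is evaluation at \<open>(a\<^sub>1, \<dots>, a\<^sub>n)\<close>, extended by 0 to functions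
  that are not n-multilinear forms, and the tensor power is the span of these.
  The universal property is \<open>tensor_universal\<close> below.
\<close>

type_synonym ('v, 'k) tensor = "('v list \<Rightarrow> 'k) \<Rightarrow> 'k"

definition pure_tensor ::
  "('k::field \<Rightarrow> 'v::ab_group_add \<Rightarrow> 'v) \<Rightarrow> nat \<Rightarrow> 'v list \<Rightarrow> ('v, 'k) tensor"
  where "pure_tensor s n xs = (\<lambda>\<phi>. if multilinear s (*) n \<phi> then \<phi> xs else 0)"

abbreviation tensor_scale :: "'k::field \<Rightarrow> ('v, 'k) tensor \<Rightarrow> ('v, 'k) tensor"
  where "tensor_scale \<equiv> fun_scale (*)"

definition tensor_power ::
  "('k::field \<Rightarrow> 'v::ab_group_add \<Rightarrow> 'v) \<Rightarrow> nat \<Rightarrow> ('v, 'k) tensor set"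
  where "tensor_power s n = module.span tensor_scale {pure_tensor s n xs | xs. length xs = n}"

text \<open>Linear maps defined on a subspace \<open>A\<close> are represented by total functions vanishing outside \<open>A\<close>.\<close>

definition linear_from ::
  "('k \<Rightarrow> 'a::ab_group_add \<Rightarrow> 'a) \<Rightarrow> ('k \<Rightarrow> 'b::ab_group_add \<Rightarrow> 'b) \<Rightarrow> 'a set \<Rightarrow> ('a \<Rightarrow> 'b) \<Rightarrow> bool"
  where "linear_from s t A g \<longleftrightarrow>
    (\<forall>x\<in>A. \<forall>y\<in>A. g (x + y) = g x + g y) \<and>
    (\<forall>c. \<forall>x\<in>A. g (s c x) = t c (g x)) \<and>
    (\<forall>x. x \<notin> A \<longrightarrow> g x = 0)"

definition tensor_lift ::
  "('k::field \<Rightarrow> 'v::ab_group_add \<Rightarrow> 'v) \<Rightarrow> ('k \<Rightarrow> 'w::ab_group_add \<Rightarrow> 'w) \<Rightarrow> nat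
    \<Rightarrow> ('v list \<Rightarrow> 'w) \<Rightarrow> ('v, 'k) tensor \<Rightarrow> 'w"
  where "tensor_lift s t n f =
    (THE g. linear_from tensor_scale t (tensor_power s n) g \<and>
       (\<forall>xs. length xs = n \<longrightarrow> g (pure_tensor s n xs) = f xs))"

text \<open>The identification of \<open>V\<^sup>m \<otimes> V\<^sup>n\<close> (tensor powers) with the (m+n)-th tensor power.\<close>

definition tensor_prod ::
  "('k::field \<Rightarrow> 'v::ab_group_add \<Rightarrow> 'v) \<Rightarrow> nat \<Rightarrow> nat \<Rightarrow> ('v, 'k) tensor \<Rightarrow> ('v, 'k) tensor \<Rightarrow> ('v, 'k) tensor"
  where "tensor_prod s m n x y =
    tensor_lift s tensor_scale m
      (\<lambda>xs. tensor_lift s tensor_scale n (\<lambda>ys. pure_tensor s (m + n) (xs @ ys)) y) x"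

type_synonym ('v, 'k) tensor_endo = "('v, 'k) tensor \<Rightarrow> ('v, 'k) tensor"

abbreviation endo_scale :: "'k::field \<Rightarrow> ('v, 'k) tensor_endo \<Rightarrow> ('v, 'k) tensor_endo"
  where "endo_scale \<equiv> fun_scale tensor_scale"

definition tensor_End ::
  "('k::field \<Rightarrow> 'v::ab_group_add \<Rightarrow> 'v) \<Rightarrow> nat \<Rightarrow> ('v, 'k) tensor_endo set"
  where "tensor_End s n = {F. linear_from tensor_scale tensor_scale (tensor_power s n) F \<and>
    F ` tensor_power s n \<subseteq> tensor_power s n}"

definition tensor_id ::
  "('k::field \<Rightarrow> 'v::ab_group_add \<Rightarrow> 'v) \<Rightarrow> nat \<Rightarrow> ('v, 'k) tensor_endo"
  where "tensor_id s n = (\<lambda>x. if x \<in> tensor_power s n then x else 0)"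

definition tensor_inv ::
  "('k::field \<Rightarrow> 'v::ab_group_add \<Rightarrow> 'v) \<Rightarrow> nat \<Rightarrow> ('v, 'k) tensor_endo \<Rightarrow> ('v, 'k) tensor_endo"
  where "tensor_inv s n F =
    (\<lambda>x. if x \<in> tensor_power s n then inv_into (tensor_power s n) F x else 0)"

text \<open>\<open>F \<otimes> G\<close> for endomorphisms \<open>F\<close>, \<open>G\<close> of the m-th and the n-th tensor power.\<close>

definition tensor_map ::
  "('k::field \<Rightarrow> 'v::ab_group_add \<Rightarrow> 'v) \<Rightarrow> nat \<Rightarrow> nat
    \<Rightarrow> ('v, 'k) tensor_endo \<Rightarrow> ('v, 'k) tensor_endo \<Rightarrow> ('v, 'k) tensor_endo"
  where "tensor_map s m n F G = tensor_lift s tensor_scale (m + n)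
    (\<lambda>zs. tensor_prod s m n (F (pure_tensor s m (take m zs))) (G (pure_tensor s n (drop m zs))))"


section \<open>The cyclic complex and its bracket\<close>

definition cyc ::
  "('k::field \<Rightarrow> 'v::ab_group_add \<Rightarrow> 'v) \<Rightarrow> nat \<Rightarrow> ('v, 'k) tensor_endo"
  where "cyc s n = tensor_lift s tensor_scale n (\<lambda>xs. pure_tensor s n (last xs # butlast xs))"

definition CdL ::
  "('k::field \<Rightarrow> 'v::ab_group_add \<Rightarrow> 'v) \<Rightarrow> nat \<Rightarrow> ('v, 'k) tensor_endo set"
  where "CdL s p = {P \<in> tensor_End s (p + 1).
    cyc s (p + 1) \<circ> P \<circ> tensor_inv s (p + 1) (cyc s (p + 1)) = endo_scale ((-1) ^ p) P}"

definition diamond ::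
  "('k::field \<Rightarrow> 'v::ab_group_add \<Rightarrow> 'v) \<Rightarrow> nat \<Rightarrow> nat
    \<Rightarrow> ('v, 'k) tensor_endo \<Rightarrow> ('v, 'k) tensor_endo \<Rightarrow> ('v, 'k) tensor_endo"
  where "diamond s p q P Q =
    tensor_map s (p + 1) q P (tensor_id s q) \<circ> tensor_map s p (q + 1) (tensor_id s p) Q"

definition square ::
  "('k::field \<Rightarrow> 'v::ab_group_add \<Rightarrow> 'v) \<Rightarrow> nat \<Rightarrow> nat
    \<Rightarrow> ('v, 'k) tensor_endo \<Rightarrow> ('v, 'k) tensor_endo \<Rightarrow> ('v, 'k) tensor_endo"
  where "square s p q P Q =
    (\<Sum>i = 0..p + q. endo_scale ((-1) ^ ((p + q) * i))
       ((cyc s (p + q + 1) ^^ i) \<circ> diamond s p q P Q \<circ>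
        (tensor_inv s (p + q + 1) (cyc s (p + q + 1)) ^^ i)))"

definition bracket_dL ::
  "('k::field \<Rightarrow> 'v::ab_group_add \<Rightarrow> 'v) \<Rightarrow> nat \<Rightarrow> nat
    \<Rightarrow> ('v, 'k) tensor_endo \<Rightarrow> ('v, 'k) tensor_endo \<Rightarrow> ('v, 'k) tensor_endo"
  where "bracket_dL s p q P Q =
    square s p q P Q - endo_scale ((-1) ^ (p * q)) (square s q p Q P)"

text \<open>The direct sum of the \<open>CdL s p\<close>: finitely supported families, with the bracket extended biadditively.\<close>

type_synonym ('v, 'k) endo_family = "nat \<Rightarrow> ('v, 'k) tensor_endo"

abbreviation family_scale :: "'k::field \<Rightarrow> ('v, 'k) endo_family \<Rightarrow> ('v, 'k) endo_family"
  where "family_scale \<equiv> fun_scale endo_scale"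

definition CdL_sum ::
  "('k::field \<Rightarrow> 'v::ab_group_add \<Rightarrow> 'v) \<Rightarrow> ('v, 'k) endo_family set"
  where "CdL_sum s = {x. (\<forall>p. x p \<in> CdL s p) \<and> finite {p. x p \<noteq> 0}}"

definition CdL_component ::
  "('k::field \<Rightarrow> 'v::ab_group_add \<Rightarrow> 'v) \<Rightarrow> nat \<Rightarrow> ('v, 'k) endo_family set"
  where "CdL_component s p = {x. x p \<in> CdL s p \<and> (\<forall>q. q \<noteq> p \<longrightarrow> x q = 0)}"

definition bracket_sum ::
  "('k::field \<Rightarrow> 'v::ab_group_add \<Rightarrow> 'v)
    \<Rightarrow> ('v, 'k) endo_family \<Rightarrow> ('v, 'k) endo_family \<Rightarrow> ('v, 'k) endo_family"
  where "bracket_sum s x y = (\<lambda>n. \<Sum>p = 0..n. bracket_dL s p (n - p) (x p) (y (n - p)))"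


section \<open>Graded Lie algebras\<close>

text \<open>\<open>L\<close> is the internal direct sum of the \<open>G p\<close>, and \<open>br\<close> is a bilinear bracket on \<open>L\<close> of degree 0.\<close>

definition graded_lie_algebra ::
  "('k::field \<Rightarrow> 'g::ab_group_add \<Rightarrow> 'g) \<Rightarrow> 'g set \<Rightarrow> (nat \<Rightarrow> 'g set) \<Rightarrow> ('g \<Rightarrow> 'g \<Rightarrow> 'g) \<Rightarrow> bool"
  where "graded_lie_algebra sc L G br \<longleftrightarrow>
    vector_space sc \<and>
    (\<forall>p. module.subspace sc (G p)) \<and>
    L = module.span sc (\<Union>p. G p) \<and>
    (\<forall>x N. (\<forall>p<N. x p \<in> G p) \<and> (\<Sum>p<N. x p) = 0 \<longrightarrow> (\<forall>p<N. x p = 0)) \<and>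
    (\<forall>x\<in>L. \<forall>y\<in>L. br x y \<in> L) \<and>
    (\<forall>x\<in>L. \<forall>y\<in>L. \<forall>z\<in>L. br (x + y) z = br x z + br y z \<and> br x (y + z) = br x y + br x z) \<and>
    (\<forall>c. \<forall>x\<in>L. \<forall>y\<in>L. br (sc c x) y = sc c (br x y) \<and> br x (sc c y) = sc c (br x y)) \<and>
    (\<forall>p q. \<forall>x\<in>G p. \<forall>y\<in>G q. br x y \<in> G (p + q)) \<and>
    (\<forall>p q. \<forall>x\<in>G p. \<forall>y\<in>G q. br x y = - sc ((-1) ^ (p * q)) (br y x)) \<and>
    (\<forall>p q r. \<forall>x\<in>G p. \<forall>y\<in>G q. \<forall>z\<in>G r.
       br x (br y z) = br (br x y) z + sc ((-1) ^ (p * q)) (br y (br x z)))"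


section \<open>Universal property of the tensor powers\<close>

lemma linear_functionals_separate:
  fixes t :: "'k::field \<Rightarrow> 'w::ab_group_add \<Rightarrow> 'w"
  assumes "vector_space t" and "\<And>h. Vector_Spaces.linear t (*) h \<Longrightarrow> h v = h w"
  shows "v = w"
proof (rule ccontr)
  assume "v \<noteq> w"
  interpret vector_space_pair t "(*) :: 'k \<Rightarrow> 'k \<Rightarrow> 'k"
    using assms(1) vector_space_field by (simp add: vector_space_pair_def)
  have ind: "vs1.independent {v - w}"
    using \<open>v \<noteq> w\<close> by simp
  let ?h = "construct {v - w} (\<lambda>_. 1)"
  have lin: "Vector_Spaces.linear t (*) ?h"
    by (rule linear_construct[OF ind])
  have "?h (v - w) = 1"
    by (rule construct_basis[OF ind]) simp
  then show False
    using assms(2)[OF lin] linear_diff[OF lin, of v w] by simp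
qed

lemma tensor_ext:
  fixes s :: "'k::field \<Rightarrow> 'v::ab_group_add \<Rightarrow> 'v" and t :: "'k \<Rightarrow> 'w::ab_group_add \<Rightarrow> 'w"
  assumes t: "vector_space t"
    and g: "linear_from tensor_scale t (tensor_power s n) g"
    and h: "linear_from tensor_scale t (tensor_power s n) h"
    and eq: "\<And>xs. length xs = n \<Longrightarrow> g (pure_tensor s n xs) = h (pure_tensor s n xs)"
  shows "g = h"
proof
  fix x
  interpret T: vector_space "tensor_scale :: 'k \<Rightarrow> ('v, 'k) tensor \<Rightarrow> _"
    by (intro vector_space_fun_scale vector_space_field)
  interpret W: vector_space t by fact
  show "g x = h x"
  proof (cases "x \<in> tensor_power s n")
    case True
    have "x \<in> tensor_power s n \<and> g x = h x"
      using True[unfolded tensor_power_def]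
    proof (induction rule: T.span_induct_alt)
      case base
      have z: "0 \<in> tensor_power s n"
        by (simp add: tensor_power_def T.span_zero)
      have "g 0 = 0" "h 0 = 0"
        using g h z unfolding linear_from_def
        by (metis T.scale_zero_left W.scale_zero_left)+
      then show ?case using z by (simp only:)
    next
      case (step c y z)
      then have y: "y \<in> tensor_power s n" and gh: "g y = h y"
        using eq by (auto simp: tensor_power_def intro: T.span_base)
      have cy: "tensor_scale c y \<in> tensor_power s n"
        using y by (simp add: tensor_power_def T.span_scale)
      have "tensor_scale c y + z \<in> tensor_power s n"
        using cy step by (simp add: tensor_power_def T.span_add)
      moreover have "g (tensor_scale c y + z) = h (tensor_scale c y + z)"
        using g h y cy step gh unfolding linear_from_def by simp
      ultimately show ?case by (simp only:)
    qed
    then show ?thesis by simp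
  next
    case False
    then show ?thesis using g h by (simp add: linear_from_def)
  qed
qed

theorem tensor_universal:
  fixes s :: "'k::field \<Rightarrow> 'v::ab_group_add \<Rightarrow> 'v" and t :: "'k \<Rightarrow> 'w::ab_group_add \<Rightarrow> 'w"
  assumes t: "vector_space t" and f: "multilinear s t n f"
  shows "\<exists>!g. linear_from tensor_scale t (tensor_power s n) g \<and>
    (\<forall>xs. length xs = n \<longrightarrow> g (pure_tensor s n xs) = f xs)"
proof (rule ex_ex1I)
  interpret T: vector_space "tensor_scale :: 'k \<Rightarrow> ('v, 'k) tensor \<Rightarrow> _"
    by (intro vector_space_fun_scale vector_space_field)
  interpret W: vector_space t by fact
  define R where "R x w \<longleftrightarrow> (\<forall>h. Vector_Spaces.linear t (*) h \<longrightarrow> h w = x (h \<circ> f))" for x w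
  have R_unique: "w = w'" if "R x w" "R x w'" for x w w'
    using that unfolding R_def by (intro linear_functionals_separate[OF t]) simp
  have R_add: "R (x + y) (w + w')" if "R x w" "R y w'" for x y w w'
    using that by (auto simp: R_def Vector_Spaces.linear_iff)
  have R_scale: "R (tensor_scale c x) (t c w)" if "R x w" for c x w
    using that by (auto simp: R_def Vector_Spaces.linear_iff fun_scale_def)
  have R_pure: "R (pure_tensor s n xs) (f xs)" for xs
  proof -
    have "multilinear s (*) n (h \<circ> f)" if "Vector_Spaces.linear t (*) h" for h
      using f that unfolding multilinear_def Vector_Spaces.linear_iff by auto
    then show ?thesis by (simp add: R_def pure_tensor_def)
  qed
  have R_zero: "R 0 0"
    using R_scale[OF R_pure, of 0] by (simp add: T.scale_zero_left)
  have R_ex: "\<exists>w. R x w" if "x \<in> tensor_power s n" for x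
    using that[unfolded tensor_power_def]
  proof (induction rule: T.span_induct_alt)
    case base
    then show ?case using R_zero by blast
  next
    case (step c y z)
    then show ?case using R_add R_scale R_pure by blast
  qed
  define g where "g x = (if x \<in> tensor_power s n then THE w. R x w else 0)" for x
  have g_eq: "g x = w" if "x \<in> tensor_power s n" "R x w" for x w
    using that R_unique by (auto simp: g_def)
  have R_g: "R x (g x)" if "x \<in> tensor_power s n" for x
    using R_ex[OF that] g_eq[OF that] by blast
  have "linear_from tensor_scale t (tensor_power s n) g"
    unfolding linear_from_def
  proof (intro conjI ballI allI impI)
    fix x y assume "x \<in> tensor_power s n" "y \<in> tensor_power s n"
    then show "g (x + y) = g x + g y"
      by (intro g_eq R_add R_g) (simp_all add: tensor_power_def T.span_add)
  next
    fix c x assume "x \<in> tensor_power s n"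
    then show "g (tensor_scale c x) = t c (g x)"
      by (intro g_eq R_scale R_g) (simp_all add: tensor_power_def T.span_scale)
  qed (simp add: g_def)
  moreover have "\<forall>xs. length xs = n \<longrightarrow> g (pure_tensor s n xs) = f xs"
  proof (intro allI impI g_eq R_pure)
    show "pure_tensor s n xs \<in> tensor_power s n" if "length xs = n" for xs :: "'v list"
      using that by (auto intro!: T.span_base simp: tensor_power_def)
  qed
  ultimately show "\<exists>g. linear_from tensor_scale t (tensor_power s n) g \<and>
    (\<forall>xs. length xs = n \<longrightarrow> g (pure_tensor s n xs) = f xs)" by blast
qed (use tensor_ext[OF t] in metis)

lemma pure_tensor_in:
  fixes s :: "'k::field \<Rightarrow> 'v::ab_group_add \<Rightarrow> 'v"
  assumes "length xs = n"
  shows "pure_tensor s n xs \<in> tensor_power s n"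
proof -
  interpret T: vector_space "tensor_scale :: 'k \<Rightarrow> ('v, 'k) tensor \<Rightarrow> _"
    by (intro vector_space_fun_scale vector_space_field)
  show ?thesis
    using assms by (auto simp: tensor_power_def intro!: T.span_base)
qed

lemma tensor_lift:
  assumes "vector_space t" and "multilinear s t n f"
  shows "linear_from tensor_scale t (tensor_power s n) (tensor_lift s t n f)"
    and "length xs = n \<Longrightarrow> tensor_lift s t n f (pure_tensor s n xs) = f xs"
  using theI'[OF tensor_universal[OF assms]] by (auto simp: tensor_lift_def)

lemma tensor_lift_in:
  fixes s :: "'k::field \<Rightarrow> 'v::ab_group_add \<Rightarrow> 'v" and t :: "'k \<Rightarrow> 'w::ab_group_add \<Rightarrow> 'w"
  assumes t: "vector_space t" and f: "multilinear s t n f" and S: "module.subspace t S"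
    and fS: "\<And>xs. length xs = n \<Longrightarrow> f xs \<in> S"
  shows "tensor_lift s t n f x \<in> S"
proof -
  interpret T: vector_space "tensor_scale :: 'k \<Rightarrow> ('v, 'k) tensor \<Rightarrow> _"
    by (intro vector_space_fun_scale vector_space_field)
  interpret W: vector_space t by fact
  let ?g = "tensor_lift s t n f"
  have g: "linear_from tensor_scale t (tensor_power s n) ?g"
    "\<And>xs. length xs = n \<Longrightarrow> ?g (pure_tensor s n xs) = f xs"
    using tensor_lift[OF t f] by blast+
  have z: "0 \<in> tensor_power s n"
    by (simp only: tensor_power_def T.span_zero)
  have g0: "?g 0 = 0"
    using g(1) z unfolding linear_from_def by (metis T.scale_zero_left W.scale_zero_left)
  show ?thesis
  proof (cases "x \<in> tensor_power s n")
    case True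
    have "x \<in> tensor_power s n \<and> ?g x \<in> S"
      using True[unfolded tensor_power_def]
    proof (induction rule: T.span_induct_alt)
      case base
      then show ?case using z g0 W.subspace_0[OF S] by (simp only:)
    next
      case (step c y u)
      then have y: "y \<in> tensor_power s n" and gy: "?g y \<in> S"
        using g(2) fS by (auto intro: pure_tensor_in)
      have cy: "tensor_scale c y \<in> tensor_power s n"
        using y by (simp only: tensor_power_def T.span_scale)
      have "tensor_scale c y + u \<in> tensor_power s n"
        using cy step by (simp only: tensor_power_def T.span_add)
      moreover have "?g (tensor_scale c y + u) = t c (?g y) + ?g u"
        using g(1) y cy step unfolding linear_from_def by (simp only:)
      ultimately show ?case
        using gy step W.subspace_add[OF S] W.subspace_scale[OF S] by (simp only:)
    qed
    then show ?thesis ..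
  next
    case False
    then show ?thesis using g(1) W.subspace_0[OF S] by (simp add: linear_from_def)
  qed
qed

lemma multilinear_pure_tensor:
  fixes s :: "'k::field \<Rightarrow> 'v::ab_group_add \<Rightarrow> 'v"
  assumes "vector_space s"
  shows "multilinear s tensor_scale n (pure_tensor s n)"
proof -
  have v: "vector_space (tensor_scale :: 'k \<Rightarrow> ('v, 'k) tensor \<Rightarrow> _)"
    by (intro vector_space_fun_scale vector_space_field)
  have "Vector_Spaces.linear s tensor_scale (\<lambda>v. pure_tensor s n (xs[i := v]))"
    if "length xs = n" "i < n" for xs :: "'v list" and i
  proof -
    have "\<phi> (xs[i := v + w]) = \<phi> (xs[i := v]) + \<phi> (xs[i := w])"
      "\<phi> (xs[i := s c v]) = c * \<phi> (xs[i := v])"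
      if "multilinear s (*) n \<phi>" for \<phi> :: "'v list \<Rightarrow> 'k" and v w c
      using that[unfolded multilinear_def, rule_format, OF \<open>length xs = n\<close> \<open>i < n\<close>]
      by (auto simp: Vector_Spaces.linear_iff)
    then show ?thesis
      using assms v by (auto simp: Vector_Spaces.linear_iff pure_tensor_def fun_eq_iff fun_scale_def)
  qed
  then show ?thesis by (simp add: multilinear_def)
qed

lemma cyc_pure_tensor:
  fixes s :: "'k::field \<Rightarrow> 'v::ab_group_add \<Rightarrow> 'v"
  assumes "vector_space s" and "length xs = n" and "n \<ge> 1"
  shows "cyc s n (pure_tensor s n xs) = pure_tensor s n (last xs # butlast xs)"
proof -
  have v: "vector_space (tensor_scale :: 'k \<Rightarrow> ('v, 'k) tensor \<Rightarrow> _)"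
    by (intro vector_space_fun_scale vector_space_field)
  have "multilinear s tensor_scale n (\<lambda>xs. pure_tensor s n (last xs # butlast xs))"
    unfolding multilinear_def
  proof (intro allI impI)
    fix xs :: "'v list" and i assume *: "length xs = n" "i < n"
    let ?zs = "last xs # butlast xs" and ?j = "if i = n - 1 then 0 else Suc i"
    have "last (xs[i := v]) # butlast (xs[i := v]) = ?zs[?j := v]" for v
      using * by (cases xs rule: rev_cases) (auto simp: list_update_append)
    moreover have "Vector_Spaces.linear s tensor_scale (\<lambda>v. pure_tensor s n (?zs[?j := v]))"
      using * by (intro multilinear_pure_tensor[OF assms(1), of n, unfolded multilinear_def, rule_format]) auto
    ultimately show "Vector_Spaces.linear s tensor_scale
        (\<lambda>v. pure_tensor s n (last (xs[i := v]) # butlast (xs[i := v])))" by simp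
  qed
  then show ?thesis
    unfolding cyc_def using tensor_lift(2)[OF v] assms(2) by blast
qed

lemma tensor_prod_aux:
  fixes s :: "'k::field \<Rightarrow> 'v::ab_group_add \<Rightarrow> 'v"
  assumes "vector_space s"
  shows "length xs = m \<Longrightarrow> multilinear s tensor_scale n (\<lambda>ys. pure_tensor s (m + n) (xs @ ys))"
    and "multilinear s tensor_scale m
      (\<lambda>xs. tensor_lift s tensor_scale n (\<lambda>ys. pure_tensor s (m + n) (xs @ ys)) y)"
proof -
  interpret T: vector_space "tensor_scale :: 'k \<Rightarrow> ('v, 'k) tensor \<Rightarrow> _"
    by (intro vector_space_fun_scale vector_space_field)
  note v = T.vector_space_axioms
  note ml = multilinear_pure_tensor[OF assms(1), of "m + n"]
  show *: "multilinear s tensor_scale n (\<lambda>ys. pure_tensor s (m + n) (xs @ ys))"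
    if "length xs = m" for xs :: "'v list"
    unfolding multilinear_def
  proof (intro allI impI)
    fix ys :: "'v list" and i assume "length ys = n" "i < n"
    then show "Vector_Spaces.linear s tensor_scale (\<lambda>v. pure_tensor s (m + n) (xs @ ys[i := v]))"
      using ml[unfolded multilinear_def, rule_format, of "xs @ ys" "m + i"] that
      by (simp add: list_update_append)
  qed
  let ?L = "\<lambda>xs. tensor_lift s tensor_scale n (\<lambda>ys. pure_tensor s (m + n) (xs @ ys))"
  show "multilinear s tensor_scale m (\<lambda>xs. ?L xs y)"
    unfolding multilinear_def
  proof (intro allI impI)
    fix xs :: "'v list" and i assume xs: "length xs = m" "i < m"
    have lin: "Vector_Spaces.linear s tensor_scale (\<lambda>v. pure_tensor s (m + n) (xs[i := v] @ ys))"
      if "length ys = n" for ys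
      using ml[unfolded multilinear_def, rule_format, of "xs @ ys" i] xs that
      by (simp add: list_update_append)
    have L: "linear_from tensor_scale tensor_scale (tensor_power s n) (?L (xs[i := v]))"
      "\<And>ys. length ys = n \<Longrightarrow> ?L (xs[i := v]) (pure_tensor s n ys) = pure_tensor s (m + n) (xs[i := v] @ ys)" for v
      using tensor_lift[OF v *] xs by (simp_all add: xs)
    have "?L (xs[i := v + w]) = ?L (xs[i := v]) + ?L (xs[i := w])" for v w
    proof (rule tensor_ext[OF v L(1)])
      show "linear_from tensor_scale tensor_scale (tensor_power s n) (?L (xs[i := v]) + ?L (xs[i := w]))"
        using L(1)[of v] L(1)[of w] unfolding linear_from_def
        by (simp add: T.scale_right_distrib algebra_simps)
    qed (use L(2) lin in \<open>simp add: Vector_Spaces.linear_iff\<close>)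
    moreover have "?L (xs[i := s c v]) = fun_scale tensor_scale c (?L (xs[i := v]))" for c v
    proof (rule tensor_ext[OF v L(1)])
      show "linear_from tensor_scale tensor_scale (tensor_power s n) (fun_scale tensor_scale c (?L (xs[i := v])))"
        using L(1)[of v] unfolding linear_from_def fun_scale_def[of tensor_scale]
        by (auto simp: T.scale_right_distrib mult.commute)
    qed (use L(2) lin in \<open>auto simp: Vector_Spaces.linear_iff fun_scale_def[of tensor_scale]\<close>)
    ultimately show "Vector_Spaces.linear s tensor_scale (\<lambda>v. ?L (xs[i := v]) y)"
      using assms(1) v by (simp add: Vector_Spaces.linear_iff fun_scale_def[of tensor_scale])
  qed
qed

lemma tensor_prod_pure_tensor:
  fixes s :: "'k::field \<Rightarrow> 'v::ab_group_add \<Rightarrow> 'v"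
  assumes "vector_space s" and "length xs = m" and "length ys = n"
  shows "tensor_prod s m n (pure_tensor s m xs) (pure_tensor s n ys) = pure_tensor s (m + n) (xs @ ys)"
proof -
  have v: "vector_space (tensor_scale :: 'k \<Rightarrow> ('v, 'k) tensor \<Rightarrow> _)"
    by (intro vector_space_fun_scale vector_space_field)
  show ?thesis
    unfolding tensor_prod_def
    using tensor_lift(2)[OF v tensor_prod_aux(2)[OF assms(1)] assms(2)]
      tensor_lift(2)[OF v tensor_prod_aux(1)[OF assms(1,2)] assms(3)] by simp
qed

lemma linear_from_tensor_prod:
  fixes s :: "'k::field \<Rightarrow> 'v::ab_group_add \<Rightarrow> 'v"
  assumes "vector_space s"
  shows "linear_from tensor_scale tensor_scale (tensor_power s m) (\<lambda>x. tensor_prod s m n x y)"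
    and "linear_from tensor_scale tensor_scale (tensor_power s n) (tensor_prod s m n x)"
proof -
  interpret T: vector_space "tensor_scale :: 'k \<Rightarrow> ('v, 'k) tensor \<Rightarrow> _"
    by (intro vector_space_fun_scale vector_space_field)
  note v = T.vector_space_axioms
  let ?L = "\<lambda>xs. tensor_lift s tensor_scale n (\<lambda>ys. pure_tensor s (m + n) (xs @ ys))"
  have l: "linear_from tensor_scale tensor_scale (tensor_power s m) (\<lambda>x. tensor_prod s m n x y)"
    and p: "\<And>xs. length xs = m \<Longrightarrow> tensor_prod s m n (pure_tensor s m xs) y = ?L xs y" for y
    unfolding tensor_prod_def using tensor_lift[OF v tensor_prod_aux(2)[OF assms(1)]] by auto
  show "linear_from tensor_scale tensor_scale (tensor_power s m) (\<lambda>x. tensor_prod s m n x y)"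
    by (rule l)
  have L: "linear_from tensor_scale tensor_scale (tensor_power s n) (?L xs)" if "length xs = m" for xs
    using tensor_lift(1)[OF v tensor_prod_aux(1)[OF assms(1) that]] .
  have "(\<lambda>x. tensor_prod s m n x (y + y')) = (\<lambda>x. tensor_prod s m n x y + tensor_prod s m n x y')"
    if "y \<in> tensor_power s n" "y' \<in> tensor_power s n" for y y'
  proof (rule tensor_ext[OF v l])
    show "linear_from tensor_scale tensor_scale (tensor_power s m)
        (\<lambda>x. tensor_prod s m n x y + tensor_prod s m n x y')"
      using l[of y] l[of y'] by (simp add: linear_from_def T.scale_right_distrib algebra_simps)
  qed (use L that in \<open>simp add: p linear_from_def\<close>)
  moreover have "(\<lambda>x. tensor_prod s m n x (tensor_scale c y)) = (\<lambda>x. tensor_scale c (tensor_prod s m n x y))"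
    if "y \<in> tensor_power s n" for c y
  proof (rule tensor_ext[OF v l])
    show "linear_from tensor_scale tensor_scale (tensor_power s m)
        (\<lambda>x. tensor_scale c (tensor_prod s m n x y))"
      using l[of y] by (simp add: linear_from_def T.scale_right_distrib mult.commute)
  qed (use L that in \<open>simp add: p linear_from_def\<close>)
  moreover have "(\<lambda>x. tensor_prod s m n x y) = (\<lambda>x. 0)" if "y \<notin> tensor_power s n" for y
  proof (rule tensor_ext[OF v l])
    show "linear_from tensor_scale tensor_scale (tensor_power s m) (\<lambda>x :: ('v, 'k) tensor. 0 :: ('v, 'k) tensor)"
      by (simp add: linear_from_def fun_scale_def fun_eq_iff)
  qed (use L that in \<open>simp add: p linear_from_def\<close>)
  ultimately show "linear_from tensor_scale tensor_scale (tensor_power s n) (tensor_prod s m n x)"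
    unfolding linear_from_def fun_eq_iff[where 'a = "('v, 'k) tensor"] by blast
qed

lemma tensor_prod_in:
  fixes s :: "'k::field \<Rightarrow> 'v::ab_group_add \<Rightarrow> 'v"
  assumes "vector_space s"
  shows "tensor_prod s m n x y \<in> tensor_power s (m + n)"
proof -
  interpret T: vector_space "tensor_scale :: 'k \<Rightarrow> ('v, 'k) tensor \<Rightarrow> _"
    by (intro vector_space_fun_scale vector_space_field)
  note v = T.vector_space_axioms
  have sub: "T.subspace (tensor_power s (m + n))"
    by (simp only: tensor_power_def T.subspace_span)
  show ?thesis
    unfolding tensor_prod_def
    by (intro tensor_lift_in[OF v _ sub] tensor_prod_aux assms pure_tensor_in) auto
qed

text \<open>\<open>(F \<otimes> G) (x \<otimes> y) = F x \<otimes> G y\<close>.\<close>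

lemma tensor_map_tensor_prod:
  fixes s :: "'k::field \<Rightarrow> 'v::ab_group_add \<Rightarrow> 'v"
  assumes "vector_space s" and F: "F \<in> tensor_End s m" and G: "G \<in> tensor_End s n"
    and x: "x \<in> tensor_power s m" and y: "y \<in> tensor_power s n"
  shows "tensor_map s m n F G (tensor_prod s m n x y) = tensor_prod s m n (F x) (G y)"
proof -
  interpret T: vector_space "tensor_scale :: 'k \<Rightarrow> ('v, 'k) tensor \<Rightarrow> _"
    by (intro vector_space_fun_scale vector_space_field)
  note v = T.vector_space_axioms
  note p1 = linear_from_tensor_prod(1)[OF assms(1)] and p2 = linear_from_tensor_prod(2)[OF assms(1)]
  note mp = multilinear_pure_tensor[OF assms(1), unfolded multilinear_def, rule_format]
  let ?f = "\<lambda>zs. tensor_prod s m n (F (pure_tensor s m (take m zs))) (G (pure_tensor s n (drop m zs)))"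
  have F': "F z \<in> tensor_power s m" if "z \<in> tensor_power s m" for z
    using F that by (auto simp: tensor_End_def)
  have G': "G z \<in> tensor_power s n" if "z \<in> tensor_power s n" for z
    using G that by (auto simp: tensor_End_def)
  have FG: "linear_from tensor_scale tensor_scale (tensor_power s m) (\<lambda>x. tensor_prod s m n (F x) b)"
    "linear_from tensor_scale tensor_scale (tensor_power s n) (\<lambda>y. tensor_prod s m n a (G y))" for a b
  proof -
    have "linear_from tensor_scale tensor_scale (tensor_power s m) F"
      "linear_from tensor_scale tensor_scale (tensor_power s n) G"
      using F G by (auto simp: tensor_End_def)
    moreover have "tensor_prod s m n 0 b = 0" "tensor_prod s m n a 0 = 0" for a b
    proof -
      have z: "0 \<in> tensor_power s n" for n
        by (simp only: tensor_power_def T.span_zero)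
      show "tensor_prod s m n 0 b = 0" "tensor_prod s m n a 0 = 0"
        using p1[of m n b] p2[of n m a] z[of m] z[of n] unfolding linear_from_def
        by (metis T.scale_zero_left)+
    qed
    ultimately show "linear_from tensor_scale tensor_scale (tensor_power s m) (\<lambda>x. tensor_prod s m n (F x) b)"
      "linear_from tensor_scale tensor_scale (tensor_power s n) (\<lambda>y. tensor_prod s m n a (G y))"
      using p1[of m n b] p2[of n m a] F' G' unfolding linear_from_def by metis+
  qed
  have lin_comp: "Vector_Spaces.linear s tensor_scale (\<lambda>w. h (pure_tensor s k (zs[i := w])))"
    if "linear_from tensor_scale tensor_scale (tensor_power s k) h" "length zs = k" "i < k"
    for h :: "('v, 'k) tensor \<Rightarrow> ('v, 'k) tensor" and k zs i
    using that(1) mp[OF that(2,3)] pure_tensor_in[of "zs[i := _]" k s] that(2)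
    by (simp add: Vector_Spaces.linear_iff linear_from_def)
  have ml: "multilinear s tensor_scale (m + n) ?f"
    unfolding multilinear_def
  proof (intro allI impI)
    fix zs :: "'v list" and i assume zs: "length zs = m + n" "i < m + n"
    show "Vector_Spaces.linear s tensor_scale (\<lambda>w. ?f (zs[i := w]))"
    proof (cases "i < m")
      case True
      then show ?thesis
        using lin_comp[OF FG(1), of "take m zs" i] zs by (simp add: take_update_swap)
    next
      case False
      then show ?thesis
        using lin_comp[OF FG(2), of "drop m zs" "i - m"] zs by (simp add: drop_update_swap)
    qed
  qed
  let ?M = "tensor_map s m n F G"
  have M: "linear_from tensor_scale tensor_scale (tensor_power s (m + n)) ?M"
    "\<And>zs. length zs = m + n \<Longrightarrow> ?M (pure_tensor s (m + n) zs) = ?f zs"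
    unfolding tensor_map_def using tensor_lift[OF v ml] by blast+
  have M0: "?M 0 = 0"
  proof -
    have "0 \<in> tensor_power s (m + n)"
      by (simp only: tensor_power_def T.span_zero)
    then show ?thesis
      using M(1) unfolding linear_from_def by (metis T.scale_zero_left)
  qed
  have M1: "linear_from tensor_scale tensor_scale (tensor_power s m) (\<lambda>x. ?M (tensor_prod s m n x y))" for y
    using M(1) M0 p1[of m n y] tensor_prod_in[OF assms(1), of m n] by (simp only: linear_from_def) auto
  have M2: "linear_from tensor_scale tensor_scale (tensor_power s n) (\<lambda>y. ?M (tensor_prod s m n x y))" for x
    using M(1) M0 p2[of n m x] tensor_prod_in[OF assms(1), of m n] by (simp only: linear_from_def) auto
  have pure: "?M (tensor_prod s m n (pure_tensor s m xs) y) = tensor_prod s m n (F (pure_tensor s m xs)) (G y)"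
    if "length xs = m" for xs y
    using tensor_ext[OF v M2 FG(2), of "pure_tensor s m xs" "F (pure_tensor s m xs)"] that
    by (simp add: tensor_prod_pure_tensor[OF assms(1)] M(2) fun_eq_iff[where 'a = "('v, 'k) tensor"])
  show ?thesis
    using tensor_ext[OF v M1 FG(1), of y "G y"] pure by (simp add: fun_eq_iff[where 'a = "('v, 'k) tensor"])
qed

end

theory Submission
  imports Defs
begin

text \<open>
  Write \<open>P@f\<close> for an endomorphism \<open>P\<close> acting on the tensor factors listed in \<open>f\<close>, for example
  \<open>P \<otimes> id = P@[0, \<dots>, p]\<close>. Conjugation by the cyclic permutation of \<open>n\<close> factors adds 1 modulo \<open>n\<close> to
  every entry of \<open>f\<close> (\<open>rot_place\<close>), and for \<open>P\<close> in \<open>CdL s p\<close> a rotation of the list \<open>f\<close> only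
  multiplies \<open>P@f\<close> by a sign (\<open>place_rotate\<close>). Such a \<open>P\<close> is thus a polygon with \<open>p + 1\<close> vertices
  drawn on the circle of tensor factors. The diamond product is \<open>P@[0, \<dots>, p] Q@[p, \<dots>, p + q]\<close>, two
  polygons sharing one vertex, and the square product is the signed sum of its cyclic rotations.

  Up to cyclic rotation, expanding the inner of two nested square products produces triples of
  polygons composed in the order \<open>A\<close>, \<open>B\<close>, \<open>C\<close>. In \<open>(A \<box> B) \<box> C\<close> the polygon \<open>C\<close> is attached at a vertex of
  \<open>A\<close> not shared with \<open>B\<close>, or at a vertex of \<open>B\<close>; in \<open>A \<box> (B \<box> C)\<close> the polygon \<open>A\<close> is attached at a
  vertex of \<open>B\<close>, or at a vertex of \<open>C\<close> not shared with \<open>B\<close>. The configurations with \<open>B\<close> in the middle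
  are the same in both, so that
  \<open>A \<box> (B \<box> C) - (A \<box> B) \<box> C = third_meets_both - first_meets_both\<close>
  (\<open>square_square_left\<close>, \<open>square_square_right\<close>). In the first of these terms \<open>A\<close> and \<open>B\<close> act on
  disjoint factors, in the second \<open>B\<close> and \<open>C\<close> do. Operators on disjoint factors commute, hence the
  first is graded symmetric in \<open>A\<close>, \<open>B\<close> and the second in \<open>B\<close>, \<open>C\<close>
  (\<open>third_meets_both_commute\<close>, \<open>first_meets_both_commute\<close>). The Jacobi identity says that the graded
  alternating sum of the associator over all orders of its three arguments vanishes, and a term
  symmetric in two neighbouring arguments contributes nothing to that sum.

  A tensor is a functional on multilinear forms, so an endomorphism is determined by
  the transposed operator on forms (\<open>E_apply\<close>). The properties of \<open>P@f\<close> thereby become identities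
  between substitutions in lists; for commutation over disjoint lists it is also used that
  two tensors can be applied to a form in either order (\<open>tensor_fubini\<close>).
\<close>

section \<open>Tensors as functionals on multilinear forms\<close>

locale tensor_space =
  fixes s :: "'k::field \<Rightarrow> 'v::ab_group_add \<Rightarrow> 'v"
  assumes vs: "vector_space s"
begin

text \<open>As rewrite rules, the pointwise laws would also expand sums and multiples of tensors
  that stand as arguments of endomorphisms; they are used explicitly instead.\<close>

declare plus_fun_apply [simp del] zero_fun_apply [simp del]

lemmas pointwise = plus_fun_apply zero_fun_apply

lemma scale_pointwise: "tensor_scale c x \<phi> = c * x \<phi>" for x :: "('v, 'k) tensor"
  by (simp add: fun_scale_def)

lemma endo_scale_pointwise: "endo_scale c F x = tensor_scale c (F x)" for F :: "('v, 'k) tensor_endo"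
  by (simp add: fun_scale_def[of tensor_scale])

abbreviation T where "T \<equiv> tensor_power s"
abbreviation pure where "pure \<equiv> pure_tensor s"
abbreviation form where "form \<equiv> multilinear s ((*) :: 'k \<Rightarrow> 'k \<Rightarrow> 'k)"
abbreviation E where "E \<equiv> tensor_End s"

sublocale TV: vector_space "tensor_scale :: 'k \<Rightarrow> ('v, 'k) tensor \<Rightarrow> _"
  by (intro vector_space_fun_scale vector_space_field)

sublocale EV: vector_space "endo_scale :: 'k \<Rightarrow> ('v, 'k) tensor_endo \<Rightarrow> _"
  by (intro vector_space_fun_scale vector_space_field)

lemma subspace_T: "TV.subspace (T n)"
  by (simp only: tensor_power_def TV.subspace_span)

lemmas T_zero = TV.subspace_0[OF subspace_T]
  and T_add = TV.subspace_add[OF subspace_T]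
  and T_scale = TV.subspace_scale[OF subspace_T]

lemma T_induct [consumes 1, case_names zero pure add scale]:
  assumes "x \<in> T n"
    and "Q 0" and "\<And>xs. length xs = n \<Longrightarrow> Q (pure n xs)"
    and "\<And>x y. x \<in> T n \<Longrightarrow> y \<in> T n \<Longrightarrow> Q x \<Longrightarrow> Q y \<Longrightarrow> Q (x + y)"
    and "\<And>c x. x \<in> T n \<Longrightarrow> Q x \<Longrightarrow> Q (tensor_scale c x)"
  shows "Q x"
proof -
  have "x \<in> T n \<and> Q x"
    using assms(1)[unfolded tensor_power_def]
  proof (induction rule: TV.span_induct_alt)
    case base
    show ?case using T_zero assms(2) by blast
  next
    case (step c y z)
    then have "y \<in> T n" "Q y" using assms(3) pure_tensor_in by blast+
    then show ?case using step assms(4,5) T_add T_scale by metis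
  qed
  then show ?thesis ..
qed

lemma form_lin:
  assumes "form n \<phi>" "length zs = n" "i < n"
  shows "\<phi> (zs[i := v + w]) = \<phi> (zs[i := v]) + \<phi> (zs[i := w])"
    and "\<phi> (zs[i := s c v]) = c * \<phi> (zs[i := v])"
  using assms by (auto simp: multilinear_def Vector_Spaces.linear_iff)

lemma formI:
  assumes "\<And>zs i v w. length zs = n \<Longrightarrow> i < n \<Longrightarrow> \<phi> (zs[i := v + w]) = \<phi> (zs[i := v]) + \<phi> (zs[i := w])"
    and "\<And>zs i v c. length zs = n \<Longrightarrow> i < n \<Longrightarrow> \<phi> (zs[i := s c v]) = c * \<phi> (zs[i := v])"
  shows "form n \<phi>"
  using assms vs vector_space_field by (auto simp: multilinear_def Vector_Spaces.linear_iff)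

lemma form_cong:
  assumes "\<And>xs. length xs = n \<Longrightarrow> \<phi> xs = \<psi> xs"
  shows "form n \<phi> \<longleftrightarrow> form n \<psi>"
  using assms by (simp add: multilinear_def)

lemma pure_apply: "form n \<phi> \<Longrightarrow> pure n xs \<phi> = \<phi> xs"
  by (simp add: pure_tensor_def)

lemma tensor_not_form: "x \<in> T n \<Longrightarrow> \<not> form n \<phi> \<Longrightarrow> x \<phi> = 0"
  by (induction rule: T_induct) (auto simp: pure_tensor_def scale_pointwise pointwise)

text \<open>Multilinearity constrains only lists of length \<open>n\<close>, so the substitutions below, which are
  well behaved on such lists only, may be rewritten under a tensor.\<close>

lemma tensor_cong:
  assumes "x \<in> T n" "\<And>xs. length xs = n \<Longrightarrow> \<phi> xs = \<psi> xs"
  shows "x \<phi> = x \<psi>"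
  using assms form_cong[of n \<phi> \<psi>]
  by (induction rule: T_induct) (auto simp: pure_tensor_def scale_pointwise pointwise)

lemma tensor_zero_form: "x \<in> T n \<Longrightarrow> x (\<lambda>_. 0) = 0"
  by (induction rule: T_induct) (auto simp: pure_tensor_def scale_pointwise pointwise)

lemma tensor_add_form:
  assumes "x \<in> T n" "form n \<phi>" "form n \<psi>"
  shows "x (\<lambda>xs. \<phi> xs + \<psi> xs) = x \<phi> + x \<psi>"
proof -
  have "form n (\<lambda>xs. \<phi> xs + \<psi> xs)"
    using form_lin[OF assms(2)] form_lin[OF assms(3)] by (intro formI) (auto simp: algebra_simps)
  with assms show ?thesis
    by (induction rule: T_induct) (auto simp: pure_apply scale_pointwise pointwise algebra_simps)
qed

lemma tensor_scale_form:
  assumes "x \<in> T n" "form n \<phi>"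
  shows "x (\<lambda>xs. c * \<phi> xs) = c * x \<phi>"
proof -
  have "form n (\<lambda>xs. c * \<phi> xs)"
    using form_lin[OF assms(2)] by (intro formI) (auto simp: algebra_simps)
  with assms show ?thesis
    by (induction rule: T_induct) (auto simp: pure_apply scale_pointwise pointwise algebra_simps)
qed

text \<open>A tensor is a combination of evaluations, and an evaluation commutes with every
  functional applied to the other variable.\<close>

lemma tensor_fubini:
  assumes x: "x \<in> T m" and y: "y \<in> T n"
    and l: "\<And>ys. length ys = n \<Longrightarrow> form m (\<lambda>xs. \<Phi> xs ys)"
    and r: "\<And>xs. length xs = m \<Longrightarrow> form n (\<lambda>ys. \<Phi> xs ys)"
  shows "x (\<lambda>xs. y (\<lambda>ys. \<Phi> xs ys)) = y (\<lambda>ys. x (\<lambda>xs. \<Phi> xs ys))"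
proof -
  have add: "y (\<lambda>ys. \<Phi> (xs[i := v + w]) ys) = y (\<lambda>ys. \<Phi> (xs[i := v]) ys) + y (\<lambda>ys. \<Phi> (xs[i := w]) ys)"
    if "length xs = m" "i < m" for xs i v w
  proof -
    have "y (\<lambda>ys. \<Phi> (xs[i := v + w]) ys) = y (\<lambda>ys. \<Phi> (xs[i := v]) ys + \<Phi> (xs[i := w]) ys)"
      using form_lin(1)[OF l that] by (intro tensor_cong[OF y])
    also have "\<dots> = y (\<lambda>ys. \<Phi> (xs[i := v]) ys) + y (\<lambda>ys. \<Phi> (xs[i := w]) ys)"
      using that by (intro tensor_add_form[OF y] r) auto
    finally show ?thesis .
  qed
  have scale: "y (\<lambda>ys. \<Phi> (xs[i := s c v]) ys) = c * y (\<lambda>ys. \<Phi> (xs[i := v]) ys)"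
    if "length xs = m" "i < m" for xs i c v
  proof -
    have "y (\<lambda>ys. \<Phi> (xs[i := s c v]) ys) = y (\<lambda>ys. c * \<Phi> (xs[i := v]) ys)"
      using form_lin(2)[OF l that] by (intro tensor_cong[OF y])
    also have "\<dots> = c * y (\<lambda>ys. \<Phi> (xs[i := v]) ys)"
      using that by (intro tensor_scale_form[OF y] r) auto
    finally show ?thesis .
  qed
  have ml: "form m (\<lambda>xs. y (\<lambda>ys. \<Phi> xs ys))"
    by (intro formI add scale)
  have x_form: "form n (\<lambda>ys. x (\<lambda>xs. \<Phi> xs ys))" if "x \<in> T m" for x
  proof (rule formI)
    fix zs :: "'v list" and i v w assume z: "length zs = n" "i < n"
    have "x (\<lambda>xs. \<Phi> xs (zs[i := v + w])) = x (\<lambda>xs. \<Phi> xs (zs[i := v]) + \<Phi> xs (zs[i := w]))"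
      using form_lin(1)[OF r z] by (intro tensor_cong[OF that])
    also have "\<dots> = x (\<lambda>xs. \<Phi> xs (zs[i := v])) + x (\<lambda>xs. \<Phi> xs (zs[i := w]))"
      using z by (intro tensor_add_form[OF that] l) auto
    finally show "x (\<lambda>xs. \<Phi> xs (zs[i := v + w])) = x (\<lambda>xs. \<Phi> xs (zs[i := v])) + x (\<lambda>xs. \<Phi> xs (zs[i := w]))" .
  next
    fix zs :: "'v list" and i v c assume z: "length zs = n" "i < n"
    have "x (\<lambda>xs. \<Phi> xs (zs[i := s c v])) = x (\<lambda>xs. c * \<Phi> xs (zs[i := v]))"
      using form_lin(2)[OF r z] by (intro tensor_cong[OF that])
    also have "\<dots> = c * x (\<lambda>xs. \<Phi> xs (zs[i := v]))"
      using z by (intro tensor_scale_form[OF that] l) auto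
    finally show "x (\<lambda>xs. \<Phi> xs (zs[i := s c v])) = c * x (\<lambda>xs. \<Phi> xs (zs[i := v]))" .
  qed
  from x show ?thesis
  proof (induction rule: T_induct)
    case zero
    show ?case by (simp add: pointwise tensor_zero_form[OF y])
  next
    case (pure xs)
    have "y (\<lambda>ys. pure m xs (\<lambda>xs. \<Phi> xs ys)) = y (\<lambda>ys. \<Phi> xs ys)"
      using l by (intro tensor_cong[OF y]) (simp add: pure_apply)
    then show ?case by (simp add: pure_apply[OF ml])
  next
    case (add u w)
    then show ?case by (simp add: pointwise tensor_add_form[OF y x_form x_form])
  next
    case (scale c u)
    then show ?case by (simp add: scale_pointwise tensor_scale_form[OF y x_form])
  qed
qed

section \<open>Endomorphisms of a tensor power\<close>

lemma E_lin:
  assumes "F \<in> E n"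
  shows "x \<in> T n \<Longrightarrow> y \<in> T n \<Longrightarrow> F (x + y) = F x + F y"
    and "x \<in> T n \<Longrightarrow> F (tensor_scale c x) = tensor_scale c (F x)"
    and "x \<notin> T n \<Longrightarrow> F x = 0"
    and "F x \<in> T n"
proof -
  show "x \<in> T n \<Longrightarrow> y \<in> T n \<Longrightarrow> F (x + y) = F x + F y"
    and "x \<in> T n \<Longrightarrow> F (tensor_scale c x) = tensor_scale c (F x)"
    and 1: "x \<notin> T n \<Longrightarrow> F x = 0"
    using assms by (auto simp: tensor_End_def linear_from_def)
  show "F x \<in> T n"
    using assms 1 T_zero by (cases "x \<in> T n") (auto simp: tensor_End_def)
qed

lemma E_I:
  assumes "\<And>x y. x \<in> T n \<Longrightarrow> y \<in> T n \<Longrightarrow> F (x + y) = F x + F y"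
    and "\<And>c x. x \<in> T n \<Longrightarrow> F (tensor_scale c x) = tensor_scale c (F x)"
    and "\<And>x. x \<notin> T n \<Longrightarrow> F x = 0"
    and "\<And>xs. length xs = n \<Longrightarrow> F (pure n xs) \<in> T n"
  shows "F \<in> E n"
proof -
  have "F 0 = 0"
    using assms(2)[OF T_zero, of 0] by (simp add: TV.scale_zero_left)
  have "F x \<in> T n" if "x \<in> T n" for x
    using that
    by (induction rule: T_induct) (auto simp: assms \<open>F 0 = 0\<close> T_zero T_add T_scale)
  then show ?thesis
    using assms by (auto simp: tensor_End_def linear_from_def)
qed

lemma E_zero_arg: "F \<in> E n \<Longrightarrow> F 0 = 0"
  using E_lin(2)[OF _ T_zero, of F n 0] by (simp add: TV.scale_zero_left)

lemma E_ext:
  assumes F: "F \<in> E n" and G: "G \<in> E n"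
    and eq: "\<And>xs \<phi>. length xs = n \<Longrightarrow> form n \<phi> \<Longrightarrow> F (pure n xs) \<phi> = G (pure n xs) \<phi>"
  shows "F = G"
proof (rule tensor_ext[OF TV.vector_space_axioms])
  show "linear_from tensor_scale tensor_scale (T n) F" "linear_from tensor_scale tensor_scale (T n) G"
    using F G by (auto simp: tensor_End_def)
  fix xs :: "'v list" assume xs: "length xs = n"
  show "F (pure n xs) = G (pure n xs)"
  proof
    fix \<phi>
    show "F (pure n xs) \<phi> = G (pure n xs) \<phi>"
      using eq[OF xs] tensor_not_form[OF E_lin(4)[OF F]] tensor_not_form[OF E_lin(4)[OF G]]
      by (cases "form n \<phi>") auto
  qed
qed

lemma form_transpose:
  assumes "F \<in> E n" "form n \<phi>"
  shows "form n (\<lambda>zs. F (pure n zs) \<phi>)"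
proof -
  have p: "pure n (zs[i := v + w]) = pure n (zs[i := v]) + pure n (zs[i := w])"
    "pure n (zs[i := s c v]) = tensor_scale c (pure n (zs[i := v]))"
    if "length zs = n" "i < n" for zs i v w c
    using multilinear_pure_tensor[OF vs, of n] that by (auto simp: multilinear_def Vector_Spaces.linear_iff)
  show ?thesis
    using assms(1) by (intro formI) (simp_all add: p E_lin pure_tensor_in, simp_all add: pointwise scale_pointwise)
qed

text \<open>Every endomorphism is the transpose of an operator on forms. This evaluates a composite on
  a pure tensor: the outer factor is moved into the form to which the inner one is applied.\<close>

lemma E_apply:
  assumes F: "F \<in> E n" and x: "x \<in> T n" and \<phi>: "form n \<phi>"
  shows "F x \<phi> = x (\<lambda>zs. F (pure n zs) \<phi>)"
  using x form_transpose[OF F \<phi>]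
  by (induction rule: T_induct)
    (simp_all add: E_lin[OF F] E_zero_arg[OF F] pure_apply, simp_all add: pointwise scale_pointwise)

lemma E_zero: "0 \<in> E n"
  by (rule E_I) (simp_all add: pointwise T_zero)

lemma E_add: "F \<in> E n \<Longrightarrow> G \<in> E n \<Longrightarrow> F + G \<in> E n"
  by (rule E_I) (auto simp: plus_fun_apply[where 'a = "('v, 'k) tensor"] E_lin T_add TV.scale_right_distrib algebra_simps)

lemma E_scale: "F \<in> E n \<Longrightarrow> endo_scale c F \<in> E n"
  by (rule E_I) (auto simp: endo_scale_pointwise E_lin T_scale TV.scale_right_distrib mult.commute)

lemma subspace_E: "EV.subspace (E n)"
  by (intro EV.subspaceI E_zero E_add E_scale)

lemmas E_sum = EV.subspace_sum[OF subspace_E]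

lemma E_comp: "F \<in> E n \<Longrightarrow> G \<in> E n \<Longrightarrow> F \<circ> G \<in> E n"
  by (rule E_I) (auto simp: E_lin E_zero_arg)

lemma comp_add_left: "(F + G) \<circ> H = (F \<circ> H) + (G \<circ> (H :: ('v, 'k) tensor_endo))"
  for F G :: "('v, 'k) tensor_endo"
  by (simp add: fun_eq_iff pointwise)

lemma comp_scale_left: "endo_scale c F \<circ> H = endo_scale c (F \<circ> (H :: ('v, 'k) tensor_endo))"
  for F :: "('v, 'k) tensor_endo"
  by (simp add: fun_eq_iff fun_scale_def)

lemma comp_sum_left: "sum F I \<circ> H = (\<Sum>i\<in>I. F i \<circ> (H :: ('v, 'k) tensor_endo))"
  for F :: "'i \<Rightarrow> ('v, 'k) tensor_endo"
  by (induction I rule: infinite_finite_induct) (simp_all add: comp_add_left, simp_all add: fun_eq_iff pointwise)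

lemma comp_add_right: "F \<in> E n \<Longrightarrow> G \<in> E n \<Longrightarrow> H \<in> E n \<Longrightarrow> F \<circ> (G + H) = (F \<circ> G) + (F \<circ> H)"
  by (rule ext) (simp add: E_lin plus_fun_apply[where 'a = "('v, 'k) tensor"])

lemma comp_scale_right: "F \<in> E n \<Longrightarrow> G \<in> E n \<Longrightarrow> F \<circ> endo_scale c G = endo_scale c (F \<circ> G)"
  by (rule ext) (simp add: E_lin endo_scale_pointwise)

lemma comp_sum_right:
  assumes "F \<in> E n" "\<And>i. i \<in> I \<Longrightarrow> G i \<in> E n"
  shows "F \<circ> sum G I = (\<Sum>i\<in>I. F \<circ> G i)"
  using assms(2)
proof (induction I rule: infinite_finite_induct)
  case (insert i I)
  then show ?case
    using comp_add_right[OF assms(1), of "G i" "sum G I"] by (simp add: E_sum del: o_apply)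
qed (use E_zero_arg[OF assms(1)] in \<open>auto simp: fun_eq_iff[where 'a = "('v, 'k) tensor"] zero_fun_apply[where 'a = "('v, 'k) tensor"]\<close>)

end

section \<open>Slots in a list\<close>

definition slots :: "nat \<Rightarrow> nat list \<Rightarrow> bool"
  where "slots n f \<longleftrightarrow> distinct f \<and> set f \<subseteq> {..<n}"

definition pick :: "nat list \<Rightarrow> 'a list \<Rightarrow> 'a list"
  where "pick f zs = map ((!) zs) f"

text \<open>The entries of \<open>zs\<close> at the positions \<open>f\<close> are replaced by \<open>xs\<close>, in the order given by \<open>f\<close>.
  Reading \<open>zip f xs\<close> as a finite map leaves the other entries unchanged.\<close>

definition upd :: "nat list \<Rightarrow> 'a list \<Rightarrow> 'a list \<Rightarrow> 'a list"
  where "upd f xs zs =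
    map (\<lambda>i. case map_of (zip f xs) i of Some x \<Rightarrow> x | None \<Rightarrow> zs ! i) [0..<length zs]"

lemma length_pick [simp]: "length (pick f zs) = length f"
  by (simp add: pick_def)

lemma nth_pick [simp]: "k < length f \<Longrightarrow> pick f zs ! k = zs ! (f ! k)"
  by (simp add: pick_def)

lemma length_upd [simp]: "length (upd f xs zs) = length zs"
  by (simp add: upd_def)

lemma slots_nth: "slots n f \<Longrightarrow> k < length f \<Longrightarrow> f ! k < n"
  unfolding slots_def using nth_mem by blast

lemma nth_upd_slot:
  assumes "slots (length zs) f" "length xs = length f" "k < length f"
  shows "upd f xs zs ! (f ! k) = xs ! k"
  using assms slots_nth[OF assms(1,3)]
  by (simp add: upd_def slots_def map_of_zip_nth)

lemma nth_upd_other: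
  assumes "length xs = length f" "i < length zs" "i \<notin> set f"
  shows "upd f xs zs ! i = zs ! i"
proof -
  have "i \<notin> fst ` set (zip f xs)"
    using assms(3) by (auto dest: set_zip_leftD)
  then have "map_of (zip f xs) i = None"
    by (simp add: map_of_eq_None_iff)
  then show ?thesis
    using assms(2) by (simp add: upd_def del: map_of_eq_None_iff)
qed

lemma upd_eqI:
  assumes "slots (length zs) f" "length xs = length f" "length ws = length zs"
    and "\<And>k. k < length f \<Longrightarrow> ws ! (f ! k) = xs ! k"
    and "\<And>i. i < length zs \<Longrightarrow> i \<notin> set f \<Longrightarrow> ws ! i = zs ! i"
  shows "upd f xs zs = ws"
proof (rule nth_equalityI)
  fix i assume i: "i < length (upd f xs zs)"
  show "upd f xs zs ! i = ws ! i"
  proof (cases "i \<in> set f")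
    case True
    then obtain k where "k < length f" "i = f ! k" by (auto simp: in_set_conv_nth)
    then show ?thesis using assms nth_upd_slot by metis
  next
    case False
    then show ?thesis using assms nth_upd_other i by (metis length_upd)
  qed
qed (use assms in simp)

lemma pick_upd_same:
  "slots (length zs) f \<Longrightarrow> length xs = length f \<Longrightarrow> pick f (upd f xs zs) = xs"
  by (intro nth_equalityI) (simp_all add: nth_upd_slot)

lemma pick_upd_disjoint:
  assumes "slots (length zs) g" "length xs = length f" "set f \<inter> set g = {}"
  shows "pick g (upd f xs zs) = pick g zs"
  using assms slots_nth[OF assms(1)] nth_mem[of _ g]
  by (intro nth_equalityI) (auto intro!: nth_upd_other)

lemma upd_upd_same:
  "slots (length zs) f \<Longrightarrow> length xs = length f \<Longrightarrow> length ys = length f \<Longrightarrow>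
    upd f ys (upd f xs zs) = upd f ys zs"
  by (intro upd_eqI) (simp_all add: nth_upd_slot nth_upd_other)

lemma upd_commute:
  assumes "slots (length zs) f" "slots (length zs) g" "set f \<inter> set g = {}"
    and "length xs = length f" "length ys = length g"
  shows "upd f xs (upd g ys zs) = upd g ys (upd f xs zs)"
proof (rule upd_eqI)
  fix k assume k: "k < length f"
  then have "f ! k \<notin> set g" "f ! k < length zs"
    using assms(3) nth_mem[OF k] slots_nth[OF assms(1) k] by (auto simp: disjoint_iff)
  then show "upd g ys (upd f xs zs) ! (f ! k) = xs ! k"
    using assms k by (simp add: nth_upd_slot nth_upd_other)
next
  fix i assume "i < length (upd g ys zs)" "i \<notin> set f"
  then show "upd g ys (upd f xs zs) ! i = upd g ys zs ! i"
    using assms by (cases "i \<in> set g") (auto simp: in_set_conv_nth nth_upd_slot nth_upd_other)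
qed (use assms in auto)

lemma slots_pick:
  assumes "slots n g" "slots (length g) f"
  shows "slots n (pick f g)"
  using assms slots_nth[OF assms(2)]
  by (auto simp: slots_def pick_def distinct_map inj_on_def nth_eq_iff_index_eq subset_iff)

lemma pick_pick:
  assumes "slots (length g) f"
  shows "pick f (pick g zs) = pick (pick f g) zs"
  using slots_nth[OF assms] by (intro nth_equalityI) auto

text \<open>Writing into the sublist picked by \<open>g\<close> and putting it back is writing at composed
  positions; \<open>place\<close> inherits its functoriality in the list of positions from this.\<close>

lemma upd_pick:
  assumes g: "slots (length zs) g" and f: "slots (length g) f" and l: "length ys = length f"
  shows "upd g (upd f ys (pick g zs)) zs = upd (pick f g) ys zs"
proof (rule sym, rule upd_eqI)
  show "slots (length zs) (pick f g)" by (rule slots_pick[OF g f])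
next
  fix k assume "k < length (pick f g)"
  then show "upd g (upd f ys (pick g zs)) zs ! (pick f g ! k) = ys ! k"
    using assms slots_nth[OF f] by (simp add: nth_upd_slot)
next
  fix i assume i: "i < length zs" "i \<notin> set (pick f g)"
  show "upd g (upd f ys (pick g zs)) zs ! i = zs ! i"
  proof (cases "i \<in> set g")
    case True
    then obtain k where k: "k < length g" "i = g ! k" by (auto simp: in_set_conv_nth)
    then have "k \<notin> set f" using i(2) by (auto simp: pick_def)
    then show ?thesis using assms k by (simp add: nth_upd_slot nth_upd_other)
  next
    case False
    then show ?thesis using i by (simp add: nth_upd_other)
  qed
qed (use l in auto)

lemma pick_update_slot:
  assumes "slots (length zs) f" "k < length f"
  shows "pick f (zs[f ! k := v]) = (pick f zs)[k := v]"
  using assms slots_nth[OF assms(1)]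
  by (intro nth_equalityI) (auto simp: nth_list_update slots_def nth_eq_iff_index_eq)

lemma pick_update_other: "i \<notin> set f \<Longrightarrow> pick f (zs[i := v]) = pick f zs"
  unfolding pick_def by (intro map_cong refl nth_list_update_neq) auto

lemma upd_update_slot:
  assumes "slots (length zs) f" "length xs = length f" "k < length f"
  shows "upd f xs (zs[f ! k := v]) = upd f xs zs"
  using assms nth_mem[of k f]
  by (intro upd_eqI) (auto simp: nth_upd_slot nth_upd_other nth_list_update slots_nth)

lemma upd_update_other:
  assumes "slots (length zs) f" "length xs = length f" "i < length zs" "i \<notin> set f"
  shows "upd f xs (zs[i := v]) = (upd f xs zs)[i := v]"
  using assms nth_mem[of _ f]
  by (intro upd_eqI) (auto simp: nth_upd_slot nth_upd_other nth_list_update)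

lemma upd_update_value:
  assumes "slots (length zs) f" "length xs = length f" "k < length f"
  shows "upd f (xs[k := v]) zs = (upd f xs zs)[f ! k := v]"
  using assms slots_nth[OF assms(1)] nth_mem[of k f]
  by (intro upd_eqI)
    (auto simp: nth_upd_slot nth_upd_other nth_list_update slots_def nth_eq_iff_index_eq)


section \<open>Endomorphisms acting on chosen tensor factors\<close>

context tensor_space
begin

text \<open>The transpose of an operator \<open>D\<close> on forms.\<close>

definition dual_op :: "nat \<Rightarrow> (('v list \<Rightarrow> 'k) \<Rightarrow> ('v list \<Rightarrow> 'k)) \<Rightarrow> ('v, 'k) tensor_endo"
  where "dual_op n D = (\<lambda>x \<phi>. if x \<in> T n \<and> form n \<phi> then x (D \<phi>) else 0)"

lemma
  assumes D: "\<And>\<phi>. form n \<phi> \<Longrightarrow> form n (D \<phi>)"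
    and im: "\<And>zs. length zs = n \<Longrightarrow> (\<lambda>\<phi>. if form n \<phi> then D \<phi> zs else 0) \<in> T n"
  shows dual_op_in_E: "dual_op n D \<in> E n"
    and dual_op_pure: "\<And>zs \<phi>. length zs = n \<Longrightarrow> form n \<phi> \<Longrightarrow> dual_op n D (pure n zs) \<phi> = D \<phi> zs"
proof -
  show p: "dual_op n D (pure n zs) \<phi> = D \<phi> zs" if "length zs = n" "form n \<phi>" for zs \<phi>
    using that D pure_tensor_in[OF that(1), of s] by (simp add: dual_op_def pure_apply)
  show "dual_op n D \<in> E n"
  proof (rule E_I)
    fix x y assume xy: "x \<in> T n" "y \<in> T n"
    show "dual_op n D (x + y) = dual_op n D x + dual_op n D y"
      using xy T_add[OF xy] by (simp add: dual_op_def fun_eq_iff pointwise)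
  next
    fix c x assume x: "x \<in> T n"
    show "dual_op n D (tensor_scale c x) = tensor_scale c (dual_op n D x)"
      using x T_scale[OF x] by (simp add: dual_op_def fun_eq_iff scale_pointwise)
  next
    fix x assume "x \<notin> T n"
    then show "dual_op n D x = 0" by (simp add: dual_op_def fun_eq_iff pointwise)
  next
    fix zs :: "'v list" assume z: "length zs = n"
    have "dual_op n D (pure n zs) = (\<lambda>\<phi>. if form n \<phi> then D \<phi> zs else 0)"
      using p[OF z] by (auto simp: dual_op_def)
    then show "dual_op n D (pure n zs) \<in> T n" using im[OF z] by simp
  qed
qed

text \<open>By uniqueness of the lift, the endomorphisms that are given by universal properties can
  be compared with explicit ones on pure tensors, without rechecking multilinearity.\<close>

lemma tensor_lift_eqI:
  assumes "F \<in> E n" "\<And>zs. length zs = n \<Longrightarrow> F (pure n zs) = h zs"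
  shows "tensor_lift s tensor_scale n h = F"
  unfolding tensor_lift_def
proof (rule the_equality)
  show "linear_from tensor_scale tensor_scale (T n) F \<and> (\<forall>xs. length xs = n \<longrightarrow> F (pure n xs) = h xs)"
    using assms by (simp add: tensor_End_def)
  then show "g = F"
    if "linear_from tensor_scale tensor_scale (T n) g \<and> (\<forall>xs. length xs = n \<longrightarrow> g (pure n xs) = h xs)" for g
    using that by (intro tensor_ext[OF TV.vector_space_axioms]) auto
qed

text \<open>\<open>P\<close> acting on the tensor factors listed in \<open>f\<close>, as an explicit operator on forms: the
  arguments at \<open>f\<close> are fed to \<open>P\<close>, and the resulting tensor is evaluated on the form in which those
  arguments have become variable.\<close>

definition place :: "nat \<Rightarrow> nat list \<Rightarrow> ('v, 'k) tensor_endo \<Rightarrow> ('v, 'k) tensor_endo"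
  where "place n f P =
    dual_op n (\<lambda>\<phi> zs. P (pure (length f) (pick f zs)) (\<lambda>xs. \<phi> (upd f xs zs)))"

lemma form_upd:
  assumes "form n \<phi>" "slots n f" "length zs = n"
  shows "form (length f) (\<lambda>xs. \<phi> (upd f xs zs))"
  using assms slots_nth[OF assms(2)]
  by (intro formI) (simp_all add: upd_update_value form_lin[OF assms(1)])

lemma spread_in_T:
  assumes "y \<in> T (length f)" "slots n f" "length zs = n"
  shows "(\<lambda>\<phi>. if form n \<phi> then y (\<lambda>xs. \<phi> (upd f xs zs)) else 0) \<in> T n"
  using assms(1)
proof (induction rule: T_induct)
  case zero
  from T_zero show ?case
    by (rule back_subst[where P = "\<lambda>x. x \<in> T n"]) (auto simp: pointwise)
next
  case (pure xs)
  have "(\<lambda>\<phi>. if form n \<phi> then pure (length f) xs (\<lambda>xs. \<phi> (upd f xs zs)) else 0) = pure n (upd f xs zs)"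
    using form_upd assms by (auto simp: pure_tensor_def)
  then show ?case using pure_tensor_in[of "upd f xs zs" n s] assms by simp
next
  case (add x y)
  from T_add[OF add.IH] show ?case
    by (rule back_subst[where P = "\<lambda>x. x \<in> T n"]) (auto simp: pointwise)
next
  case (scale c x)
  from T_scale[OF scale.IH, of c] show ?case
    by (rule back_subst[where P = "\<lambda>x. x \<in> T n"]) (auto simp: scale_pointwise)
qed

lemma
  assumes P: "P \<in> E (length f)" and f: "slots n f"
  shows place_in_E: "place n f P \<in> E n"
    and place_pure: "\<And>zs \<phi>. length zs = n \<Longrightarrow> form n \<phi> \<Longrightarrow>
      place n f P (pure n zs) \<phi> = P (pure (length f) (pick f zs)) (\<lambda>xs. \<phi> (upd f xs zs))"
proof -
  let ?m = "length f"
  let ?D = "\<lambda>\<phi> zs. P (pure ?m (pick f zs)) (\<lambda>xs. \<phi> (upd f xs zs))"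
  have D: "form n (?D \<phi>)" if \<phi>: "form n \<phi>" for \<phi>
  proof -
    have in_T: "P x \<in> T ?m" for x by (rule E_lin(4)[OF P])
    have slot: "?D \<phi> (zs[i := v]) = P (pure ?m ((pick f zs)[k := v])) (\<lambda>xs. \<phi> (upd f xs zs))"
      if "length zs = n" "k < ?m" "i = f ! k" for zs i k v
      using that f by (simp add: pick_update_slot) (auto intro!: tensor_cong[OF in_T] simp: upd_update_slot)
    have other: "?D \<phi> (zs[i := v]) = P (pure ?m (pick f zs)) (\<lambda>xs. \<phi> ((upd f xs zs)[i := v]))"
      if "length zs = n" "i < n" "i \<notin> set f" for zs i v
      using that f by (simp add: pick_update_other) (auto intro!: tensor_cong[OF in_T] simp: upd_update_other)
    have form': "form ?m (\<lambda>xs. \<phi> ((upd f xs zs)[i := v]))"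
      if "length zs = n" "i < n" "i \<notin> set f" for zs i v
    proof -
      have "form ?m (\<lambda>xs. \<phi> (upd f xs (zs[i := v])))"
        using that f \<phi> by (intro form_upd) auto
      then show ?thesis
        by (subst form_cong[of ?m _ "\<lambda>xs. \<phi> (upd f xs (zs[i := v]))"])
          (use that f in \<open>auto simp: upd_update_other\<close>)
    qed
    show ?thesis
    proof (rule formI)
      fix zs :: "'v list" and i v w assume z: "length zs = n" "i < n"
      show "?D \<phi> (zs[i := v + w]) = ?D \<phi> (zs[i := v]) + ?D \<phi> (zs[i := w])"
      proof (cases "i \<in> set f")
        case True
        then obtain k where k: "k < ?m" "i = f ! k" by (auto simp: in_set_conv_nth)
        have "form ?m (\<lambda>us. P (pure ?m us) (\<lambda>xs. \<phi> (upd f xs zs)))"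
          using z f by (intro form_transpose[OF P] form_upd[OF \<phi>]) auto
        from form_lin(1)[OF this, of "pick f zs" k v w] show ?thesis
          using k z by (simp add: slot)
      next
        case False
        have "?D \<phi> (zs[i := v + w]) = P (pure ?m (pick f zs))
            (\<lambda>xs. \<phi> ((upd f xs zs)[i := v]) + \<phi> ((upd f xs zs)[i := w]))"
          using False z by (simp add: other form_lin[OF \<phi>])
        also have "\<dots> = ?D \<phi> (zs[i := v]) + ?D \<phi> (zs[i := w])"
          using False z by (simp add: other tensor_add_form[OF in_T] form')
        finally show ?thesis .
      qed
    next
      fix zs :: "'v list" and i v c assume z: "length zs = n" "i < n"
      show "?D \<phi> (zs[i := s c v]) = c * ?D \<phi> (zs[i := v])"
      proof (cases "i \<in> set f")
        case True
        then obtain k where k: "k < ?m" "i = f ! k" by (auto simp: in_set_conv_nth)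
        have "form ?m (\<lambda>us. P (pure ?m us) (\<lambda>xs. \<phi> (upd f xs zs)))"
          using z f by (intro form_transpose[OF P] form_upd[OF \<phi>]) auto
        from form_lin(2)[OF this, of "pick f zs" k c v] show ?thesis
          using k z by (simp add: slot)
      next
        case False
        have "?D \<phi> (zs[i := s c v]) = P (pure ?m (pick f zs)) (\<lambda>xs. c * \<phi> ((upd f xs zs)[i := v]))"
          using False z by (simp add: other form_lin[OF \<phi>])
        also have "\<dots> = c * ?D \<phi> (zs[i := v])"
          using False z by (simp add: other tensor_scale_form[OF in_T] form')
        finally show ?thesis .
      qed
    qed
  qed
  have im: "(\<lambda>\<phi>. if form n \<phi> then ?D \<phi> zs else 0) \<in> T n" if "length zs = n" for zs
    by (rule spread_in_T[OF E_lin(4)[OF P] f that])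
  show "place n f P \<in> E n"
    unfolding place_def by (rule dual_op_in_E[OF D im])
  show "place n f P (pure n zs) \<phi> = ?D \<phi> zs" if "length zs = n" "form n \<phi>" for zs \<phi>
    unfolding place_def by (rule dual_op_pure[OF D im that])
qed

lemma place_add:
  assumes "P \<in> E (length f)" "Q \<in> E (length f)" "slots n f"
  shows "place n f (P + Q) = place n f P + place n f Q"
  by (rule E_ext[of _ n])
    (use assms in \<open>simp_all add: place_in_E E_add place_pure, simp_all add: pointwise place_pure\<close>)

lemma place_scale:
  assumes "P \<in> E (length f)" "slots n f"
  shows "place n f (endo_scale c P) = endo_scale c (place n f P)"
  by (rule E_ext[of _ n])
    (use assms in \<open>simp_all add: place_in_E E_scale place_pure endo_scale_pointwise scale_pointwise\<close>)

lemma place_zero: "place n f 0 = 0"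
  by (auto simp: place_def dual_op_def fun_eq_iff pointwise tensor_zero_form)

lemma place_sum:
  assumes "\<And>i. i \<in> I \<Longrightarrow> P i \<in> E (length f)" "slots n f"
  shows "place n f (sum P I) = (\<Sum>i\<in>I. place n f (P i))"
  using assms(1)
  by (induction I rule: infinite_finite_induct) (simp_all add: place_zero place_add E_sum assms(2))

lemma place_comp:
  assumes P: "P \<in> E (length f)" and Q: "Q \<in> E (length f)" and f: "slots n f"
  shows "place n f (P \<circ> Q) = place n f P \<circ> place n f Q"
proof (rule E_ext[of _ n])
  let ?m = "length f"
  fix zs :: "'v list" and \<phi> assume z: "length zs = n" and \<phi>: "form n \<phi>"
  have q: "pure ?m (pick f zs) \<in> T ?m" by (simp add: pure_tensor_in)
  note pl = place_in_E[OF P f] place_in_E[OF Q f]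
  have "(place n f P \<circ> place n f Q) (pure n zs) \<phi> = place n f Q (pure n zs) (\<lambda>ws. place n f P (pure n ws) \<phi>)"
    using E_apply[OF pl(1) E_lin(4)[OF pl(2)] \<phi>] by simp
  also have "\<dots> = Q (pure ?m (pick f zs)) (\<lambda>xs. place n f P (pure n (upd f xs zs)) \<phi>)"
    by (rule place_pure[OF Q f z form_transpose[OF pl(1) \<phi>]])
  also have "\<dots> = Q (pure ?m (pick f zs)) (\<lambda>xs. P (pure ?m xs) (\<lambda>ys. \<phi> (upd f ys zs)))"
  proof (rule tensor_cong[OF E_lin(4)[OF Q]])
    fix xs :: "'v list" assume x: "length xs = ?m"
    have "place n f P (pure n (upd f xs zs)) \<phi> = P (pure ?m xs) (\<lambda>ys. \<phi> (upd f ys (upd f xs zs)))"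
      using x z \<phi> f by (simp add: place_pure[OF P f] pick_upd_same)
    also have "\<dots> = P (pure ?m xs) (\<lambda>ys. \<phi> (upd f ys zs))"
      using x z f by (intro tensor_cong[OF E_lin(4)[OF P]]) (simp add: upd_upd_same)
    finally show "place n f P (pure n (upd f xs zs)) \<phi> = P (pure ?m xs) (\<lambda>ys. \<phi> (upd f ys zs))" .
  qed
  also have "\<dots> = (P \<circ> Q) (pure ?m (pick f zs)) (\<lambda>ys. \<phi> (upd f ys zs))"
    using E_apply[OF P E_lin(4)[OF Q] form_upd[OF \<phi> f z]] by simp
  also have "\<dots> = place n f (P \<circ> Q) (pure n zs) \<phi>"
    using place_pure[OF E_comp[OF P Q] f z \<phi>] by simp
  finally show "place n f (P \<circ> Q) (pure n zs) \<phi> = (place n f P \<circ> place n f Q) (pure n zs) \<phi>" ..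
qed (use assms in \<open>simp_all add: place_in_E E_comp\<close>)

lemma place_place:
  assumes P: "P \<in> E (length f)" and g: "slots n g" and f: "slots (length g) f"
  shows "place n g (place (length g) f P) = place n (pick f g) P"
proof (rule E_ext[of _ n])
  fix zs :: "'v list" and \<phi> assume z: "length zs = n" and \<phi>: "form n \<phi>"
  have fg: "slots n (pick f g)" by (rule slots_pick[OF g f])
  have "place n g (place (length g) f P) (pure n zs) \<phi>
      = P (pure (length f) (pick f (pick g zs))) (\<lambda>ys. \<phi> (upd g (upd f ys (pick g zs)) zs))"
    using z \<phi> by (simp add: place_pure[OF place_in_E[OF P f] g] place_pure[OF P f] form_upd[OF \<phi> g])
  also have "\<dots> = P (pure (length f) (pick (pick f g) zs)) (\<lambda>ys. \<phi> (upd (pick f g) ys zs))"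
    unfolding pick_pick[OF f]
    using z g f by (intro tensor_cong[OF E_lin(4)[OF P]]) (simp add: upd_pick)
  also have "\<dots> = place n (pick f g) P (pure n zs) \<phi>"
    using place_pure[of P "pick f g", OF _ fg z \<phi>] P by simp
  finally show "place n g (place (length g) f P) (pure n zs) \<phi> = place n (pick f g) P (pure n zs) \<phi>" .
qed (use assms in \<open>simp_all add: place_in_E slots_pick\<close>)

text \<open>Evaluating either composite on a pure tensor applies the tensors produced by \<open>P\<close> and by
  \<open>Q\<close> successively to the same form in two groups of variables.\<close>

lemma place_commute:
  assumes P: "P \<in> E (length f)" and Q: "Q \<in> E (length g)"
    and f: "slots n f" and g: "slots n g" and fg: "set f \<inter> set g = {}"
  shows "place n f P \<circ> place n g Q = place n g Q \<circ> place n f P"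
proof (rule E_ext[of _ n])
  fix zs :: "'v list" and \<phi> assume z: "length zs = n" and \<phi>: "form n \<phi>"
  have comp: "(place n f P \<circ> place n g Q) (pure n zs) \<phi>
    = Q (pure (length g) (pick g zs)) (\<lambda>ys. P (pure (length f) (pick f zs)) (\<lambda>xs. \<phi> (upd f xs (upd g ys zs))))"
    if P: "P \<in> E (length f)" and Q: "Q \<in> E (length g)"
      and f: "slots n f" and g: "slots n g" and fg: "set f \<inter> set g = {}" for P Q f g
  proof -
    note pl = place_in_E[OF P f] place_in_E[OF Q g]
    have "(place n f P \<circ> place n g Q) (pure n zs) \<phi> = place n g Q (pure n zs) (\<lambda>ws. place n f P (pure n ws) \<phi>)"
      using E_apply[OF pl(1) E_lin(4)[OF pl(2)] \<phi>] by simp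
    also have "\<dots> = Q (pure (length g) (pick g zs)) (\<lambda>ys. place n f P (pure n (upd g ys zs)) \<phi>)"
      by (rule place_pure[OF Q g z form_transpose[OF pl(1) \<phi>]])
    also have "\<dots> = Q (pure (length g) (pick g zs))
        (\<lambda>ys. P (pure (length f) (pick f zs)) (\<lambda>xs. \<phi> (upd f xs (upd g ys zs))))"
      using z f g fg \<phi>
      by (intro tensor_cong[OF E_lin(4)[OF Q]])
        (simp add: place_pure[OF P f] pick_upd_disjoint Int_commute)
    finally show ?thesis .
  qed
  have "(place n f P \<circ> place n g Q) (pure n zs) \<phi>
    = Q (pure (length g) (pick g zs)) (\<lambda>ys. P (pure (length f) (pick f zs)) (\<lambda>xs. \<phi> (upd f xs (upd g ys zs))))"
    by (rule comp[OF P Q f g fg])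
  also have "\<dots> = P (pure (length f) (pick f zs)) (\<lambda>xs. Q (pure (length g) (pick g zs)) (\<lambda>ys. \<phi> (upd f xs (upd g ys zs))))"
  proof (rule tensor_fubini[OF E_lin(4)[OF Q] E_lin(4)[OF P]])
    show "form (length g) (\<lambda>ys. \<phi> (upd f xs (upd g ys zs)))" if "length xs = length f" for xs
      by (subst form_cong[of _ _ "\<lambda>ys. \<phi> (upd g ys (upd f xs zs))"])
        (use that f g fg z \<phi> in \<open>auto simp: upd_commute[of zs f g] intro: form_upd\<close>)
    show "form (length f) (\<lambda>xs. \<phi> (upd f xs (upd g ys zs)))" for ys
      using z by (intro form_upd[OF \<phi> f]) simp
  qed
  also have "\<dots> = P (pure (length f) (pick f zs)) (\<lambda>xs. Q (pure (length g) (pick g zs)) (\<lambda>ys. \<phi> (upd g ys (upd f xs zs))))"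
    using f g fg z
    by (intro tensor_cong[OF E_lin(4)[OF P]] tensor_cong[OF E_lin(4)[OF Q]]) (simp add: upd_commute[of zs f g])
  also have "\<dots> = (place n g Q \<circ> place n f P) (pure n zs) \<phi>"
    by (rule comp[OF Q P g f, symmetric]) (use fg in auto)
  finally show "(place n f P \<circ> place n g Q) (pure n zs) \<phi> = (place n g Q \<circ> place n f P) (pure n zs) \<phi>" .
qed (use assms in \<open>simp_all add: place_in_E E_comp\<close>)

lemma slots_upt [simp]: "slots n [i..<j] \<longleftrightarrow> j \<le> n \<or> j \<le> i"
  by (auto simp: slots_def subset_iff) (metis diff_Suc_1 Suc_pred lessI less_Suc_eq_le linorder_not_less not_less_zero order_less_le_trans zero_less_iff_neq_zero)

lemma place_all:
  assumes P: "P \<in> E n"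
  shows "place n [0..<n] P = P"
proof (rule E_ext[OF place_in_E P])
  fix zs :: "'v list" and \<phi> assume z: "length zs = n" and \<phi>: "form n \<phi>"
  have "pick [0..<n] zs = zs" using z by (auto simp: pick_def map_nth)
  moreover have "upd [0..<n] xs zs = xs" if "length xs = n" for xs
    using that z by (intro upd_eqI) auto
  ultimately show "place n [0..<n] P (pure n zs) \<phi> = P (pure n zs) \<phi>"
    using place_pure[of P "[0..<n]" n zs \<phi>] P z \<phi> by (auto intro!: tensor_cong[OF E_lin(4)[OF P]])
qed (use P in auto)

lemma form_append_left:
  assumes "form (m + n) \<phi>" "length ys = n"
  shows "form m (\<lambda>xs. \<phi> (xs @ ys))"
  using assms(2) form_lin[OF assms(1), of "_ @ ys"]
  by (intro formI) (simp_all add: list_update_append1[symmetric])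

lemma form_append_right:
  assumes "form (m + n) \<phi>" "length xs = m"
  shows "form n (\<lambda>ys. \<phi> (xs @ ys))"
  using assms(2) form_lin[OF assms(1), of "xs @ _" "m + _"]
  by (intro formI) (simp_all add: list_update_append)

lemma tensor_prod_apply:
  assumes x: "x \<in> T m" and y: "y \<in> T n" and \<phi>: "form (m + n) \<phi>"
  shows "tensor_prod s m n x y \<phi> = x (\<lambda>xs. y (\<lambda>ys. \<phi> (xs @ ys)))"
proof -
  note l1 = linear_from_tensor_prod(1)[OF vs, unfolded linear_from_def]
  note l2 = linear_from_tensor_prod(2)[OF vs, unfolded linear_from_def]
  have z1: "tensor_prod s m n 0 y = 0" for y
    using l1[of m n y] T_zero by (metis TV.scale_zero_left)
  have z2: "tensor_prod s m n x 0 = 0" for x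
    using l2[of n m x] T_zero by (metis TV.scale_zero_left)
  note l = form_append_left[OF \<phi>] and r = form_append_right[OF \<phi>]
  have y_form: "form m (\<lambda>xs. y (\<lambda>ys. \<phi> (xs @ ys)))" if y: "y \<in> T n" for y
    using y
  proof (induction rule: T_induct)
    case zero
    show ?case by (rule formI) (simp_all add: pointwise)
  next
    case (pure ys)
    show ?case
      by (subst form_cong[of m _ "\<lambda>xs. \<phi> (xs @ ys)"]) (use l[OF pure] r in \<open>simp_all add: pure_apply\<close>)
  next
    case (add x y)
    then show ?case using form_lin[OF add(3)] form_lin[OF add(4)]
      by (intro formI) (simp_all add: pointwise algebra_simps)
  next
    case (scale c x)
    then show ?case using form_lin[OF scale(2)]
      by (intro formI) (simp_all add: scale_pointwise algebra_simps)
  qed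
  have on_pure: "tensor_prod s m n (pure m xs) y \<phi> = y (\<lambda>ys. \<phi> (xs @ ys))" if xs: "length xs = m" for xs
    using y
  proof (induction rule: T_induct)
    case zero
    show ?case by (simp only: z2) (simp add: pointwise)
  next
    case (pure ys)
    then show ?case using xs r \<phi> by (simp add: tensor_prod_pure_tensor[OF vs] pure_apply)
  next
    case (add u w)
    then have "tensor_prod s m n (pure m xs) (u + w) = tensor_prod s m n (pure m xs) u + tensor_prod s m n (pure m xs) w"
      using l2[of n m "pure m xs"] by blast
    then show ?case using add by (simp only:) (simp add: pointwise)
  next
    case (scale c u)
    then have "tensor_prod s m n (pure m xs) (tensor_scale c u) = tensor_scale c (tensor_prod s m n (pure m xs) u)"
      using l2[of n m "pure m xs"] by blast
    then show ?case using scale by (simp only:) (simp add: scale_pointwise)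
  qed
  from x show ?thesis
  proof (induction rule: T_induct)
    case zero
    show ?case by (simp only: z1) (simp add: pointwise)
  next
    case (pure xs)
    then show ?case using on_pure y_form[OF y] by (simp add: pure_apply)
  next
    case (add u w)
    then have "tensor_prod s m n (u + w) y = tensor_prod s m n u y + tensor_prod s m n w y"
      using l1[of m n y] by blast
    then show ?case using add by (simp only:) (simp add: pointwise)
  next
    case (scale c u)
    then have "tensor_prod s m n (tensor_scale c u) y = tensor_scale c (tensor_prod s m n u y)"
      using l1[of m n y] by blast
    then show ?case using scale by (simp only:) (simp add: scale_pointwise)
  qed
qed

end

section \<open>Cyclic rotation\<close>

declare upt_Suc [simp del]

lemma neg_one_power_cong: "(even a \<longleftrightarrow> even b) \<Longrightarrow> (-1 :: 'a::ring_1) ^ a = (-1) ^ b"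
  by (cases "even a") auto

definition shift :: "nat \<Rightarrow> nat \<Rightarrow> nat list \<Rightarrow> nat list"
  where "shift n k f = map (\<lambda>j. (j + k) mod n) f"

lemma length_shift [simp]: "length (shift n k f) = length f"
  by (simp add: shift_def)

lemma slots_shift:
  assumes "slots n f"
  shows "slots n (shift n k f)"
proof -
  have "inj_on (\<lambda>j. (j + k) mod n) {..<n}"
  proof (rule inj_onI)
    fix a b assume ab: "a \<in> {..<n}" "b \<in> {..<n}" "(a + k) mod n = (b + k) mod n"
    then obtain q1 q2 where "a + k + n * q1 = b + k + n * q2" by (auto simp: nat_mod_eq_iff)
    then have "a + n * q1 = b + n * q2" by simp
    then have "a mod n = b mod n" by (metis mod_mult_self2)
    then show "a = b" using ab by simp
  qed
  then have "inj_on (\<lambda>j. (j + k) mod n) (set f)"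
    using assms inj_on_subset by (auto simp: slots_def)
  moreover have "f = [] \<or> n > 0" using assms by (cases f) (auto simp: slots_def)
  ultimately show ?thesis using assms by (auto simp: slots_def shift_def distinct_map)
qed

lemma shift_shift: "shift n k (shift n l f) = shift n (l + k) f"
  by (simp add: shift_def mod_add_left_eq add.assoc)

lemma shift_append: "shift n k (f @ g) = shift n k f @ shift n k g"
  by (simp add: shift_def)

lemma shift_upt: "y + k \<le> n \<Longrightarrow> shift n k [x..<y] = [x + k..<y + k]"
  by (auto simp: shift_def intro!: nth_equalityI)

lemma shift_upt_wrap:
  assumes "n \<le> x + k" "y + k \<le> 2 * n"
  shows "shift n k [x..<y] = [x + k - n..<y + k - n]"
proof (rule nth_equalityI)
  fix i assume i: "i < length (shift n k [x..<y])"
  then have "x + i + k < 2 * n" "n \<le> x + i + k" using assms by auto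
  then have "(x + i + k) mod n = x + i + k - n"
    by (simp add: le_mod_geq)
  then show "shift n k [x..<y] ! i = [x + k - n..<y + k - n] ! i"
    using i assms by (simp add: shift_def)
qed (use assms in auto)

context tensor_space
begin

lemma T_ext:
  assumes "x \<in> T n" "y \<in> T n" "\<And>\<phi>. form n \<phi> \<Longrightarrow> x \<phi> = y \<phi>"
  shows "x = y"
  using assms tensor_not_form by (intro ext) metis

lemma tensor_map_id_right:
  assumes F: "F \<in> E m"
  shows "tensor_map s m n F (tensor_id s n) = place (m + n) [0..<m] F"
  unfolding tensor_map_def
proof (rule tensor_lift_eqI)
  show pl: "place (m + n) [0..<m] F \<in> E (m + n)"
    using F by (intro place_in_E) auto
  fix zs :: "'v list" assume z: "length zs = m + n"
  have take: "pick [0..<m] zs = take m zs"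
    using z by (intro nth_equalityI) auto
  have upd: "upd [0..<m] xs zs = xs @ drop m zs" if "length xs = m" for xs
    using that z by (intro upd_eqI) (auto simp: nth_append)
  have d: "pure n (drop m zs) \<in> T n" using z by (simp add: pure_tensor_in)
  show "place (m + n) [0..<m] F (pure (m + n) zs) =
    tensor_prod s m n (F (pure m (take m zs))) (tensor_id s n (pure n (drop m zs)))"
  proof (rule T_ext[OF E_lin(4)[OF pl] tensor_prod_in[OF vs]])
    fix \<phi> assume \<phi>: "form (m + n) \<phi>"
    have "place (m + n) [0..<m] F (pure (m + n) zs) \<phi> = F (pure m (take m zs)) (\<lambda>xs. \<phi> (upd [0..<m] xs zs))"
      using place_pure[of F "[0..<m]" "m + n" zs \<phi>] F z \<phi> by (simp add: take)
    also have "\<dots> = F (pure m (take m zs)) (\<lambda>xs. pure n (drop m zs) (\<lambda>ys. \<phi> (xs @ ys)))"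
      by (rule tensor_cong[OF E_lin(4)[OF F]]) (simp add: upd pure_apply form_append_right[OF \<phi>])
    also have "\<dots> = tensor_prod s m n (F (pure m (take m zs))) (tensor_id s n (pure n (drop m zs))) \<phi>"
      using d by (simp add: tensor_prod_apply[OF E_lin(4)[OF F] d \<phi>] tensor_id_def)
    finally show "place (m + n) [0..<m] F (pure (m + n) zs) \<phi> =
      tensor_prod s m n (F (pure m (take m zs))) (tensor_id s n (pure n (drop m zs))) \<phi>" .
  qed
qed

lemma tensor_map_id_left:
  assumes G: "G \<in> E n"
  shows "tensor_map s m n (tensor_id s m) G = place (m + n) [m..<m + n] G"
  unfolding tensor_map_def
proof (rule tensor_lift_eqI)
  show pl: "place (m + n) [m..<m + n] G \<in> E (m + n)"
    using G by (intro place_in_E) auto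
  fix zs :: "'v list" assume z: "length zs = m + n"
  have drop: "pick [m..<m + n] zs = drop m zs"
    using z by (intro nth_equalityI) auto
  have upd: "upd [m..<m + n] ys zs = take m zs @ ys" if "length ys = n" for ys
    using that z by (intro upd_eqI) (auto simp: nth_append)
  have t: "pure m (take m zs) \<in> T m" using z by (simp add: pure_tensor_in)
  show "place (m + n) [m..<m + n] G (pure (m + n) zs) =
    tensor_prod s m n (tensor_id s m (pure m (take m zs))) (G (pure n (drop m zs)))"
  proof (rule T_ext[OF E_lin(4)[OF pl] tensor_prod_in[OF vs]])
    fix \<phi> assume \<phi>: "form (m + n) \<phi>"
    let ?y = "G (pure n (drop m zs))"
    have "place (m + n) [m..<m + n] G (pure (m + n) zs) \<phi> = ?y (\<lambda>ys. \<phi> (upd [m..<m + n] ys zs))"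
      using place_pure[of G "[m..<m + n]" "m + n" zs \<phi>] G z \<phi> by (simp add: drop)
    also have "\<dots> = ?y (\<lambda>ys. \<phi> (take m zs @ ys))"
      by (rule tensor_cong[OF E_lin(4)[OF G]]) (simp add: upd)
    also have "\<dots> = ?y (\<lambda>ys. pure m (take m zs) (\<lambda>xs. \<phi> (xs @ ys)))"
      by (rule tensor_cong[OF E_lin(4)[OF G]]) (simp add: pure_apply form_append_left[OF \<phi>])
    also have "\<dots> = pure m (take m zs) (\<lambda>xs. ?y (\<lambda>ys. \<phi> (xs @ ys)))"
      by (rule tensor_fubini[OF E_lin(4)[OF G] t form_append_right[OF \<phi>] form_append_left[OF \<phi>]])
    also have "\<dots> = tensor_prod s m n (tensor_id s m (pure m (take m zs))) ?y \<phi>"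
      using t by (simp add: tensor_prod_apply[OF t E_lin(4)[OF G] \<phi>] tensor_id_def)
    finally show "place (m + n) [m..<m + n] G (pure (m + n) zs) \<phi> =
      tensor_prod s m n (tensor_id s m (pure m (take m zs))) ?y \<phi>" .
  qed
qed

text \<open>The two factors overlap in position \<open>p\<close> alone.\<close>

lemma diamond_eq:
  assumes "P \<in> E (p + 1)" "Q \<in> E (q + 1)"
  shows "diamond s p q P Q = place (p + q + 1) [0..<p + 1] P \<circ> place (p + q + 1) [p..<p + q + 1] Q"
  using tensor_map_id_right[OF assms(1), of q] tensor_map_id_left[OF assms(2), of p]
  by (simp add: diamond_def)

lemma
  assumes f: "slots n f" "length f = n"
  shows permute_in_E: "dual_op n (\<lambda>\<phi> zs. \<phi> (pick f zs)) \<in> E n"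
    and permute_pure: "length zs = n \<Longrightarrow> dual_op n (\<lambda>\<phi> zs. \<phi> (pick f zs)) (pure n zs) = pure n (pick f zs)"
proof -
  have "card (set f) = n" using f distinct_card by (auto simp: slots_def)
  then have "set f = {..<n}" using f by (intro card_subset_eq) (auto simp: slots_def)
  then have ex: "\<exists>k<n. i = f ! k" if "i < n" for i
    using that f(2) by (metis in_set_conv_nth lessThan_iff)
  have D: "form n (\<lambda>zs. \<phi> (pick f zs))" if \<phi>: "form n \<phi>" for \<phi>
  proof (rule formI)
    fix zs :: "'v list" and i v w assume z: "length zs = n" "i < n"
    obtain k where k: "k < n" "i = f ! k" using ex z by blast
    show "\<phi> (pick f (zs[i := v + w])) = \<phi> (pick f (zs[i := v])) + \<phi> (pick f (zs[i := w]))"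
      using k z f by (simp add: pick_update_slot form_lin[OF \<phi>])
  next
    fix zs :: "'v list" and i v c assume z: "length zs = n" "i < n"
    obtain k where k: "k < n" "i = f ! k" using ex z by blast
    show "\<phi> (pick f (zs[i := s c v])) = c * \<phi> (pick f (zs[i := v]))"
      using k z f by (simp add: pick_update_slot form_lin[OF \<phi>])
  qed
  have eq: "(\<lambda>\<phi>. if form n \<phi> then \<phi> (pick f zs) else 0) = pure n (pick f zs)" for zs
    by (auto simp: pure_tensor_def)
  have im: "(\<lambda>\<phi>. if form n \<phi> then \<phi> (pick f zs) else 0) \<in> T n" if "length zs = n" for zs
    unfolding eq using f by (simp add: pure_tensor_in)
  show in_E: "dual_op n (\<lambda>\<phi> zs. \<phi> (pick f zs)) \<in> E n"
    by (rule dual_op_in_E[of n "\<lambda>\<phi> zs. \<phi> (pick f zs)", OF D im])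
  show "dual_op n (\<lambda>\<phi> zs. \<phi> (pick f zs)) (pure n zs) = pure n (pick f zs)" if z: "length zs = n"
  proof (rule T_ext[OF E_lin(4)[OF in_E]])
    show "pure n (pick f zs) \<in> T n" using f by (simp add: pure_tensor_in)
  qed (simp add: dual_op_pure[of n "\<lambda>\<phi> zs. \<phi> (pick f zs)", OF D im z] pure_apply)
qed

lemma slots_shift_upt: "slots n (shift n k [0..<n])"
  by (intro slots_shift) simp

lemma pick_shift_inverse:
  assumes "length zs = n" "(k + l) mod n = 0"
  shows "pick (shift n k [0..<n]) (pick (shift n l [0..<n]) zs) = zs"
proof (rule nth_equalityI)
  fix i assume i: "i < length (pick (shift n k [0..<n]) (pick (shift n l [0..<n]) zs))"
  have "((i + k) mod n + l) mod n = (i + (k + l) mod n) mod n"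
    by (simp add: mod_add_left_eq mod_add_right_eq add.assoc)
  also have "\<dots> = i" using i assms(2) by simp
  finally show "pick (shift n k [0..<n]) (pick (shift n l [0..<n]) zs) ! i = zs ! i"
    using i by (simp add: shift_def)
qed (use assms in simp)

text \<open>Entry \<open>i\<close> of \<open>last xs # butlast xs\<close> is entry \<open>i - 1\<close> of \<open>xs\<close> modulo \<open>n\<close>. Writing this as a shift by
  \<open>n - 1\<close> turns cyclic permutation into picking along shifted positions, with the shift by 1 as
  inverse.\<close>

lemma
  assumes "n > 0"
  shows cyc_in_E: "cyc s n \<in> E n"
    and cyc_pure: "\<And>zs. length zs = n \<Longrightarrow> cyc s n (pure n zs) = pure n (pick (shift n (n - 1) [0..<n]) zs)"
    and cyc_inv_in_E: "tensor_inv s n (cyc s n) \<in> E n"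
    and cyc_inv_pure: "\<And>zs. length zs = n \<Longrightarrow> tensor_inv s n (cyc s n) (pure n zs) = pure n (pick (shift n 1 [0..<n]) zs)"
    and cyc_inv_cyc: "\<And>x. x \<in> T n \<Longrightarrow> tensor_inv s n (cyc s n) (cyc s n x) = x"
proof -
  define r where "r = dual_op n (\<lambda>\<phi> zs. \<phi> (pick (shift n (n - 1) [0..<n]) zs))"
  define l where "l = dual_op n (\<lambda>\<phi> zs. \<phi> (pick (shift n 1 [0..<n]) zs))"
  have r: "r \<in> E n" "\<And>zs. length zs = n \<Longrightarrow> r (pure n zs) = pure n (pick (shift n (n - 1) [0..<n]) zs)"
    unfolding r_def using slots_shift_upt by (intro permute_in_E permute_pure; simp)+
  have l: "l \<in> E n" "\<And>zs. length zs = n \<Longrightarrow> l (pure n zs) = pure n (pick (shift n 1 [0..<n]) zs)"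
    unfolding l_def using slots_shift_upt by (intro permute_in_E permute_pure; simp)+
  have "pick (shift n (n - 1) [0..<n]) zs = last zs # butlast zs" if "length zs = n" for zs :: "'v list"
  proof (rule nth_equalityI)
    fix i assume i: "i < length (pick (shift n (n - 1) [0..<n]) zs)"
    show "pick (shift n (n - 1) [0..<n]) zs ! i = (last zs # butlast zs) ! i"
    proof (cases i)
      case 0
      then show ?thesis using that assms by (auto simp: shift_def last_conv_nth)
    next
      case (Suc j)
      then have "(i + (n - 1)) mod n = j" using i by (simp add: le_mod_geq)
      then show ?thesis using that i Suc by (simp add: shift_def nth_butlast)
    qed
  qed (use that assms in simp)
  then have c: "cyc s n = r"
    unfolding cyc_def by (intro tensor_lift_eqI r(1)) (simp add: r(2))
  have id_E: "tensor_id s n \<in> E n"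
    by (rule E_I) (auto simp: tensor_id_def T_add T_scale pure_tensor_in)
  have rl: "r (l x) = x" if "x \<in> T n" for x
  proof -
    have "r \<circ> l = tensor_id s n"
      using assms pure_tensor_in[of _ n s]
      by (intro E_ext[OF E_comp[OF r(1) l(1)] id_E]) (simp add: r l tensor_id_def pick_shift_inverse)
    then show ?thesis using that by (auto simp: tensor_id_def fun_eq_iff[where 'a = "('v, 'k) tensor"])
  qed
  have lr: "l (r x) = x" if "x \<in> T n" for x
  proof -
    have "l \<circ> r = tensor_id s n"
      using assms pure_tensor_in[of _ n s]
      by (intro E_ext[OF E_comp[OF l(1) r(1)] id_E]) (simp add: r l tensor_id_def pick_shift_inverse)
    then show ?thesis using that by (auto simp: tensor_id_def fun_eq_iff[where 'a = "('v, 'k) tensor"])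
  qed
  have inv: "tensor_inv s n (cyc s n) = l"
  proof
    fix x
    show "tensor_inv s n (cyc s n) x = l x"
    proof (cases "x \<in> T n")
      case True
      have "inj_on r (T n)" using lr by (metis inj_onI)
      then have "inv_into (T n) r x = l x"
        using rl[OF True] E_lin(4)[OF l(1)] by (intro inv_into_f_eq)
      then show ?thesis using True by (simp add: tensor_inv_def c)
    next
      case False
      then show ?thesis by (simp add: tensor_inv_def E_lin(3)[OF l(1)])
    qed
  qed
  show "cyc s n \<in> E n" "tensor_inv s n (cyc s n) \<in> E n" using r l c inv by auto
  show "cyc s n (pure n zs) = pure n (pick (shift n (n - 1) [0..<n]) zs)"
    "tensor_inv s n (cyc s n) (pure n zs) = pure n (pick (shift n 1 [0..<n]) zs)"
    if "length zs = n" for zs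
    using that r(2) l(2) c inv by auto
  show "tensor_inv s n (cyc s n) (cyc s n x) = x" if "x \<in> T n" for x
    using that lr c inv by auto
qed

definition rot :: "nat \<Rightarrow> ('v, 'k) tensor_endo \<Rightarrow> ('v, 'k) tensor_endo"
  where "rot n X = cyc s n \<circ> X \<circ> tensor_inv s n (cyc s n)"

lemma rot_in_E: "n > 0 \<Longrightarrow> X \<in> E n \<Longrightarrow> rot n X \<in> E n"
  unfolding rot_def by (intro E_comp cyc_in_E cyc_inv_in_E)

lemma rot_pow_in_E: "n > 0 \<Longrightarrow> X \<in> E n \<Longrightarrow> (rot n ^^ k) X \<in> E n"
  by (induction k) (auto simp: rot_in_E)

lemma rot_pow: "(rot n ^^ k) X = (cyc s n ^^ k) \<circ> X \<circ> (tensor_inv s n (cyc s n) ^^ k)"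
proof (induction k)
  case (Suc k)
  have "(rot n ^^ Suc k) X = rot n ((rot n ^^ k) X)" by simp
  also have "\<dots> = cyc s n \<circ> ((cyc s n ^^ k) \<circ> X \<circ> (tensor_inv s n (cyc s n) ^^ k)) \<circ> tensor_inv s n (cyc s n)"
    by (simp only: Suc rot_def)
  finally show ?case
    by (simp only: funpow.simps(2)[of k "cyc s n"] funpow_Suc_right[of k "tensor_inv s n (cyc s n)"] o_assoc)
qed auto

lemma rot_comp:
  assumes "n > 0" "X \<in> E n" "Y \<in> E n"
  shows "rot n (X \<circ> Y) = rot n X \<circ> rot n Y"
  using cyc_inv_cyc[OF assms(1)] E_lin(4)[OF assms(3)]
  by (auto simp: rot_def fun_eq_iff[where 'a = "('v, 'k) tensor"])

lemma rot_pow_comp: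
  assumes "n > 0" "X \<in> E n" "Y \<in> E n"
  shows "(rot n ^^ k) (X \<circ> Y) = (rot n ^^ k) X \<circ> (rot n ^^ k) Y"
proof (induction k)
  case (Suc k)
  have step: "(rot n ^^ Suc k) Z = rot n ((rot n ^^ k) Z)" for Z by simp
  show ?case unfolding step Suc using assms by (intro rot_comp rot_pow_in_E)
qed simp

lemma rot_add: "n > 0 \<Longrightarrow> X \<in> E n \<Longrightarrow> Y \<in> E n \<Longrightarrow> rot n (X + Y) = rot n X + rot n Y"
  using comp_add_right[of "cyc s n" n X Y] by (simp add: rot_def cyc_in_E comp_add_left)

lemma rot_scale: "n > 0 \<Longrightarrow> X \<in> E n \<Longrightarrow> rot n (endo_scale c X) = endo_scale c (rot n X)"
  using comp_scale_right[of "cyc s n" n X c] by (simp add: rot_def cyc_in_E comp_scale_left)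

lemma rot_zero: "n > 0 \<Longrightarrow> rot n 0 = 0"
  using rot_scale[of n 0 0] E_zero by simp

lemma rot_sum:
  assumes "n > 0" "\<And>i. i \<in> I \<Longrightarrow> X i \<in> E n"
  shows "rot n (sum X I) = (\<Sum>i\<in>I. rot n (X i))"
  using assms(2)
  by (induction I rule: infinite_finite_induct) (simp_all add: rot_zero rot_add E_sum assms(1))

text \<open>The inverse permutation moves the entries at \<open>f + 1\<close> to \<open>f\<close>, where \<open>P\<close> acts, and the cyclic
  permutation moves the result back.\<close>

lemma rot_place:
  assumes n: "n > 0" and P: "P \<in> E (length f)" and f: "slots n f"
  shows "rot n (place n f P) = place n (shift n 1 f) P"
proof (rule E_ext)
  note pl = place_in_E[OF P f]
  have f': "slots n (shift n 1 f)" using f by (rule slots_shift)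
  have P': "P \<in> E (length (shift n 1 f))" using P by simp
  show "rot n (place n f P) \<in> E n" by (rule rot_in_E[OF n pl])
  show "place n (shift n 1 f) P \<in> E n" by (rule place_in_E[OF P' f'])
  fix zs :: "'v list" and \<phi> assume z: "length zs = n" and \<phi>: "form n \<phi>"
  define ws where "ws = pick (shift n 1 [0..<n]) zs"
  have ws: "length ws = n" by (simp add: ws_def)
  have c: "pure n zs' \<in> T n" if "length zs' = n" for zs' using that by (simp add: pure_tensor_in)
  have D: "form n (\<lambda>us. cyc s n (pure n us) \<phi>)" by (rule form_transpose[OF cyc_in_E[OF n] \<phi>])
  have nth_f: "f ! k < n" if "k < length f" for k using slots_nth[OF f that] .
  have "rot n (place n f P) (pure n zs) \<phi> = cyc s n (place n f P (pure n ws)) \<phi>"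
    using n z by (simp add: rot_def cyc_inv_pure ws_def)
  also have "\<dots> = place n f P (pure n ws) (\<lambda>us. cyc s n (pure n us) \<phi>)"
    by (rule E_apply[OF cyc_in_E[OF n] E_lin(4)[OF pl] \<phi>])
  also have "\<dots> = P (pure (length f) (pick f ws)) (\<lambda>xs. cyc s n (pure n (upd f xs ws)) \<phi>)"
    by (rule place_pure[OF P f ws D])
  also have "\<dots> = P (pure (length f) (pick f ws)) (\<lambda>xs. \<phi> (upd (shift n 1 f) xs zs))"
  proof (rule tensor_cong[OF E_lin(4)[OF P]])
    fix xs :: "'v list" assume x: "length xs = length f"
    have "pick (shift n (n - 1) [0..<n]) (upd f xs ws) = upd (shift n 1 f) xs zs"
    proof (rule sym, rule upd_eqI)
      fix k assume k: "k < length (shift n 1 f)"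
      then have "((f ! k + 1) mod n + (n - 1)) mod n = f ! k"
        using nth_f[of k] n mod_add_left_eq[of "f ! k + 1" n "n - 1"] by simp
      then show "pick (shift n (n - 1) [0..<n]) (upd f xs ws) ! (shift n 1 f ! k) = xs ! k"
        using k n x f ws by (simp add: shift_def nth_upd_slot)
    next
      fix i assume i: "i < length zs" "i \<notin> set (shift n 1 f)"
      let ?j = "(i + (n - 1)) mod n"
      have j: "(?j + 1) mod n = i" "?j < n" using i z n by (simp_all add: mod_Suc_eq)
      then have "?j \<notin> set f" using i(2) by (force simp: shift_def)
      then have "upd f xs ws ! ?j = ws ! ?j" using x ws j by (intro nth_upd_other) auto
      also have "\<dots> = zs ! i" using j by (simp add: ws_def shift_def)
      finally show "pick (shift n (n - 1) [0..<n]) (upd f xs ws) ! i = zs ! i"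
        using i z by (simp add: shift_def)
    qed (use f' x z in auto)
    then show "cyc s n (pure n (upd f xs ws)) \<phi> = \<phi> (upd (shift n 1 f) xs zs)"
      using n ws \<phi> by (simp add: cyc_pure pure_apply)
  qed
  also have "pick f ws = pick (shift n 1 f) zs"
    using nth_f by (intro nth_equalityI) (simp_all add: ws_def shift_def)
  also have "P (pure (length f) (pick (shift n 1 f) zs)) (\<lambda>xs. \<phi> (upd (shift n 1 f) xs zs))
      = place n (shift n 1 f) P (pure n zs) \<phi>"
    using place_pure[OF P' f' z \<phi>] by simp
  finally show "rot n (place n f P) (pure n zs) \<phi> = place n (shift n 1 f) P (pure n zs) \<phi>" .
qed

lemma rot_pow_place:
  assumes n: "n > 0" and P: "P \<in> E (length f)" and f: "slots n f"
  shows "(rot n ^^ k) (place n f P) = place n (shift n k f) P"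
proof (induction k)
  case 0
  have "shift n 0 f = f"
    using slots_nth[OF f] by (intro nth_equalityI) (simp_all add: shift_def)
  then show ?case by simp
next
  case (Suc k)
  then show ?case using assms by (simp add: rot_place slots_shift shift_shift)
qed

lemma rot_period: "n > 0 \<Longrightarrow> X \<in> E n \<Longrightarrow> (rot n ^^ n) X = X"
  using rot_pow_place[of n X "[0..<n]" n] shift_upt_wrap[of n 0 n n] by (simp add: place_all)

section \<open>The signed cyclic norm\<close>

text \<open>The norm for the action of the cyclic group of order \<open>n\<close> in which the generator acts by
  \<open>rot n\<close> times \<open>(-1) ^ (n - 1)\<close>; an endomorphism of the \<open>n\<close>-th tensor power has degree \<open>n - 1\<close>.\<close>

definition cnorm :: "nat \<Rightarrow> ('v, 'k) tensor_endo \<Rightarrow> ('v, 'k) tensor_endo"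
  where "cnorm n X = (\<Sum>i<n. endo_scale ((-1) ^ ((n - 1) * i)) ((rot n ^^ i) X))"

lemma cnorm_in_E: "n > 0 \<Longrightarrow> X \<in> E n \<Longrightarrow> cnorm n X \<in> E n"
  unfolding cnorm_def by (intro E_sum E_scale rot_pow_in_E)

lemma square_eq_cnorm: "square s p q P Q = cnorm (p + q + 1) (diamond s p q P Q)"
  unfolding square_def cnorm_def rot_pow by (intro sum.cong) auto

lemma rot_pow_add:
  "n > 0 \<Longrightarrow> X \<in> E n \<Longrightarrow> Y \<in> E n \<Longrightarrow> (rot n ^^ k) (X + Y) = (rot n ^^ k) X + (rot n ^^ k) Y"
  by (induction k) (simp_all add: rot_add rot_pow_in_E)

lemma rot_pow_scale:
  "n > 0 \<Longrightarrow> X \<in> E n \<Longrightarrow> (rot n ^^ k) (endo_scale c X) = endo_scale c ((rot n ^^ k) X)"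
  by (induction k) (simp_all add: rot_scale rot_pow_in_E)

lemma cnorm_add: "n > 0 \<Longrightarrow> X \<in> E n \<Longrightarrow> Y \<in> E n \<Longrightarrow> cnorm n (X + Y) = cnorm n X + cnorm n Y"
  by (simp add: cnorm_def rot_pow_add EV.scale_right_distrib sum.distrib)

lemma cnorm_scale: "n > 0 \<Longrightarrow> X \<in> E n \<Longrightarrow> cnorm n (endo_scale c X) = endo_scale c (cnorm n X)"
  by (simp add: cnorm_def rot_pow_scale EV.scale_sum_right mult.commute)

lemma cnorm_sum:
  assumes "n > 0" "\<And>i. i \<in> I \<Longrightarrow> X i \<in> E n"
  shows "cnorm n (sum X I) = (\<Sum>i\<in>I. cnorm n (X i))"
  using assms(2)
proof (induction I rule: infinite_finite_induct)
  case (insert i I)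
  then show ?case by (simp add: cnorm_add E_sum assms(1))
qed (use cnorm_scale[OF assms(1) E_zero, of 0] in simp_all)

text \<open>Rotating the argument permutes the summands cyclically.\<close>

lemma cnorm_rot:
  assumes n: "n > 0" and X: "X \<in> E n"
  shows "cnorm n (rot n X) = endo_scale ((-1) ^ (n - 1)) (cnorm n X)"
proof -
  let ?g = "\<lambda>i. endo_scale ((-1) ^ ((n - 1) * i)) ((rot n ^^ i) X)"
  \<comment> \<open>The sign character is defined on the cyclic group: the summands are periodic in \<open>i\<close>.\<close>
  have "even ((n - 1) * n)" by (cases n) auto
  then have g: "?g n = ?g 0" using rot_period[OF n X] by simp
  have "cnorm n (rot n X) = (\<Sum>i<n. endo_scale ((-1) ^ (n - 1)) (?g (Suc i)))"
    unfolding cnorm_def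
  proof (rule sum.cong[OF refl])
    fix i
    have "(-1 :: 'k) ^ ((n - 1) * i) = (-1) ^ (n - 1) * (-1) ^ ((n - 1) * Suc i)"
      unfolding power_add[symmetric]
      by (rule neg_one_power_cong) (simp only: mult_Suc_right even_add, blast)
    then show "endo_scale ((-1) ^ ((n - 1) * i)) ((rot n ^^ i) (rot n X))
        = endo_scale ((-1) ^ (n - 1)) (?g (Suc i))"
      by (simp add: funpow_swap1)
  qed
  also have "\<dots> = endo_scale ((-1) ^ (n - 1)) (\<Sum>i<n. ?g (Suc i))"
    by (simp add: EV.scale_sum_right)
  also have "(\<Sum>i<n. ?g (Suc i)) = (\<Sum>i<n. ?g i)"
    using sum.lessThan_Suc[of ?g n] sum.lessThan_Suc_shift[of ?g n] g by simp
  finally show ?thesis by (simp add: cnorm_def)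
qed

lemma cnorm_rot_pow:
  assumes n: "n > 0" and X: "X \<in> E n"
  shows "cnorm n ((rot n ^^ k) X) = endo_scale ((-1) ^ ((n - 1) * k)) (cnorm n X)"
  by (induction k) (simp_all add: cnorm_rot n X rot_pow_in_E power_add)

lemma rot_cnorm:
  assumes n: "n > 0" and X: "X \<in> E n"
  shows "rot n (cnorm n X) = endo_scale ((-1) ^ (n - 1)) (cnorm n X)"
proof -
  have "rot n (cnorm n X) = cnorm n (rot n X)"
    by (simp add: cnorm_def rot_sum E_scale rot_pow_in_E n X rot_scale funpow_swap1)
  then show ?thesis by (simp add: cnorm_rot n X)
qed

lemma CdL_iff: "P \<in> CdL s p \<longleftrightarrow> P \<in> E (p + 1) \<and> rot (p + 1) P = endo_scale ((-1) ^ p) P"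
  by (simp add: CdL_def rot_def)

lemma CdL_E: "P \<in> CdL s p \<Longrightarrow> P \<in> E (p + 1)"
  by (simp add: CdL_iff)

lemma cnorm_CdL: "X \<in> E (p + 1) \<Longrightarrow> cnorm (p + 1) X \<in> CdL s p"
  using rot_cnorm[of "p + 1" X] by (simp add: CdL_iff cnorm_in_E)

lemma diamond_in_E: "P \<in> E (p + 1) \<Longrightarrow> Q \<in> E (q + 1) \<Longrightarrow> diamond s p q P Q \<in> E (p + q + 1)"
  unfolding diamond_eq by (intro E_comp place_in_E) auto

lemma square_CdL: "P \<in> E (p + 1) \<Longrightarrow> Q \<in> E (q + 1) \<Longrightarrow> square s p q P Q \<in> CdL s (p + q)"
  unfolding square_eq_cnorm by (intro cnorm_CdL diamond_in_E)

text \<open>Placing along a rotated list is placing the rotated \<open>P\<close> along the original list, and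
  rotation multiplies an element of \<open>CdL s p\<close> by \<open>(-1) ^ p\<close>.\<close>

lemma place_rotate:
  assumes P: "P \<in> CdL s p" and f: "slots n f" "length f = p + 1"
  shows "place n (rotate k f) P = endo_scale ((-1) ^ (p * k)) (place n f P)"
proof (induction k)
  case (Suc k)
  let ?m = "p + 1" and ?g = "rotate k f"
  have g: "slots n ?g" "length ?g = ?m" using f by (auto simp: slots_def)
  have PE: "P \<in> E ?m" using P by (rule CdL_E)
  have "pick (shift ?m 1 [0..<?m]) ?g = rotate1 ?g"
    using g(2) by (intro nth_equalityI) (simp_all add: shift_def nth_rotate1)
  moreover have "rot ?m P = place ?m (shift ?m 1 [0..<?m]) P"
    using rot_place[of ?m P "[0..<?m]"] PE by (simp only: place_all) simp
  ultimately have "place n (rotate1 ?g) P = place n ?g (rot ?m P)"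
    using place_place[of P "shift ?m 1 [0..<?m]" n ?g] PE g slots_shift_upt[of ?m 1] by simp
  also have "\<dots> = endo_scale ((-1) ^ p) (place n ?g P)"
    using P PE g by (simp add: CdL_iff place_scale)
  finally show ?case by (simp add: Suc power_add)
qed simp

end

section \<open>Products of two cyclic elements\<close>

lemma sum_lessThan_add:
  "sum g {..<m + p} = sum g {..<m} + (\<Sum>u<p. g (m + u))" for g :: "nat \<Rightarrow> 'a::comm_monoid_add"
  by (induction p) (simp_all add: add.assoc)

lemma slots_append [simp]:
  "slots n (f @ g) \<longleftrightarrow> slots n f \<and> slots n g \<and> set f \<inter> set g = {}"
  by (auto simp: slots_def)

lemma upt_split: "i \<le> j \<Longrightarrow> j \<le> k \<Longrightarrow> [i..<k] = [i..<j] @ [j..<k]"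
  by (metis le_Suc_ex upt_add_eq_append)

lemma rotate_append_length: "k = length xs \<Longrightarrow> ys @ xs = rotate k (xs @ ys)"
  by (simp add: rotate_append)

lemma pick_upt:
  "slots m f \<Longrightarrow> pick f [x..<x + m] = map ((+) x) f"
  by (intro nth_equalityI) (auto dest: slots_nth)

lemma map_plus_upt: "map ((+) x) [i..<j] = [x + i..<x + j]"
  by (intro nth_equalityI) auto

context tensor_space
begin

text \<open>Rotating the diamond product by \<open>t\<close> with \<open>0 < t \<le> q\<close> wraps \<open>Q\<close> around the circle, and
  rotating it further, by \<open>q + 1 + u\<close>, wraps \<open>P\<close> instead. The symmetry of the wrapped factor puts its positions back
  into increasing order. In the first sum \<open>Q\<close> is inserted at vertex \<open>u\<close> of \<open>P\<close>, in the second \<open>P\<close> is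
  inserted at vertex \<open>t\<close> of \<open>Q\<close>; the shared positions are \<open>u\<close> and \<open>t + p\<close>.\<close>

lemma square_expand:
  assumes P: "P \<in> CdL s p" and Q: "Q \<in> CdL s q" and n: "n = p + q + 1"
  shows "square s p q P Q =
    (\<Sum>u<p. endo_scale ((-1) ^ (p * q + q * u))
       (place n ([0..<u + 1] @ [u + q + 1..<n]) P \<circ> place n [u..<u + q + 1] Q)) +
    (\<Sum>t\<le>q. endo_scale ((-1) ^ (p * t))
       (place n [t..<t + p + 1] P \<circ> place n ([0..<t] @ [t + p..<n]) Q))"
proof -
  note PE = CdL_E[OF P] and QE = CdL_E[OF Q]
  have n0: "n > 0" using n by simp
  let ?g = "\<lambda>i. endo_scale ((-1) ^ ((p + q) * i))
    (place n (shift n i [0..<p + 1]) P \<circ> place n (shift n i [p..<n]) Q)"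
  have "(rot n ^^ i) (diamond s p q P Q) = place n (shift n i [0..<p + 1]) P \<circ> place n (shift n i [p..<n]) Q" for i
    using PE QE n0 n
    by (simp add: diamond_eq rot_pow_comp rot_pow_place place_in_E del: o_apply)
  then have "square s p q P Q = (\<Sum>i<(q + 1) + p. ?g i)"
    using n by (simp add: square_eq_cnorm cnorm_def add_ac)
  also have "\<dots> = (\<Sum>i<q + 1. ?g i) + (\<Sum>u<p. ?g (q + 1 + u))"
    by (rule sum_lessThan_add)
  also have "(\<Sum>i<q + 1. ?g i) = (\<Sum>t\<le>q. endo_scale ((-1) ^ (p * t))
       (place n [t..<t + p + 1] P \<circ> place n ([0..<t] @ [t + p..<n]) Q))"
  proof (rule sum.cong)
    fix t assume "t \<in> {..q}"
    then have t: "t \<le> q" by simp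
    have "[p..<n] = [p..<n - t] @ [n - t..<n]"
      using t n upt_split[of p "n - t" n] by simp
    then have "shift n t [p..<n] = [t + p..<n] @ [0..<t]"
      using t n by (simp add: shift_append shift_upt shift_upt_wrap add.commute)
    also have "\<dots> = rotate t ([0..<t] @ [t + p..<n])"
      by (rule rotate_append_length) simp
    finally have sQ: "place n (shift n t [p..<n]) Q
        = endo_scale ((-1) ^ (q * t)) (place n ([0..<t] @ [t + p..<n]) Q)"
      using t n by (simp add: place_rotate[OF Q] disjoint_iff)
    have sP: "shift n t [0..<p + 1] = [t..<t + p + 1]"
      using t n by (simp add: shift_upt add.commute)
    have E: "place n [t..<t + p + 1] P \<in> E n" "place n ([0..<t] @ [t + p..<n]) Q \<in> E n"
      using t n PE QE by (auto intro!: place_in_E simp: disjoint_iff)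
    have "(-1 :: 'k) ^ ((p + q) * t) * (-1) ^ (q * t) = (-1) ^ (p * t)"
      unfolding power_add[symmetric] by (rule neg_one_power_cong) (auto simp: algebra_simps)
    then show "?g t = endo_scale ((-1) ^ (p * t))
       (place n [t..<t + p + 1] P \<circ> place n ([0..<t] @ [t + p..<n]) Q)"
      unfolding sP sQ by (simp only: comp_scale_right[OF E] EV.scale_scale)
  qed auto
  also have "(\<Sum>u<p. ?g (q + 1 + u)) = (\<Sum>u<p. endo_scale ((-1) ^ (p * q + q * u))
       (place n ([0..<u + 1] @ [u + q + 1..<n]) P \<circ> place n [u..<u + q + 1] Q))"
  proof (rule sum.cong[OF refl])
    fix u assume "u \<in> {..<p}"
    then have u: "u < p" by simp
    let ?i = "q + 1 + u"
    have "[0..<p + 1] = [0..<p - u] @ [p - u..<p + 1]"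
      using u upt_split[of 0 "p - u" "p + 1"] by simp
    then have "shift n ?i [0..<p + 1] = [u + q + 1..<n] @ [0..<u + 1]"
      using u n by (simp add: shift_append shift_upt shift_upt_wrap add_ac)
    also have "\<dots> = rotate (u + 1) ([0..<u + 1] @ [u + q + 1..<n])"
      by (rule rotate_append_length) simp
    finally have sP: "place n (shift n ?i [0..<p + 1]) P
        = endo_scale ((-1) ^ (p * (u + 1))) (place n ([0..<u + 1] @ [u + q + 1..<n]) P)"
      by (simp only:) (rule place_rotate[OF P]; use u n in \<open>auto simp: disjoint_iff\<close>)
    have sQ: "shift n ?i [p..<n] = [u..<u + q + 1]"
      using u n by (simp add: shift_upt_wrap add_ac)
    have "(-1 :: 'k) ^ ((p + q) * ?i) * (-1) ^ (p * (u + 1)) = (-1) ^ (p * q + q * u)"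
      unfolding power_add[symmetric] by (rule neg_one_power_cong) (auto simp: algebra_simps)
    then show "?g ?i = endo_scale ((-1) ^ (p * q + q * u))
       (place n ([0..<u + 1] @ [u + q + 1..<n]) P \<circ> place n [u..<u + q + 1] Q)"
      unfolding sP sQ by (simp only: comp_scale_left EV.scale_scale)
  qed
  finally show ?thesis by (simp only: add.commute)
qed

lemma square_in_E: "P \<in> CdL s p \<Longrightarrow> Q \<in> CdL s q \<Longrightarrow> square s p q P Q \<in> E (p + q + 1)"
  by (intro CdL_E square_CdL)

section \<open>Products of three cyclic elements\<close>

lemma place_comp_sum:
  assumes G: "slots n G" "length G = m"
    and A: "A \<in> E la" and B: "B \<in> E lb"
    and f: "\<And>i. i \<in> I \<Longrightarrow> slots m (f i) \<and> length (f i) = la"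
    and g: "\<And>i. i \<in> I \<Longrightarrow> slots m (g i) \<and> length (g i) = lb"
  shows "place n G (\<Sum>i\<in>I. endo_scale (c i) (place m (f i) A \<circ> place m (g i) B)) =
    (\<Sum>i\<in>I. endo_scale (c i) (place n (pick (f i) G) A \<circ> place n (pick (g i) G) B))"
    (is "?lhs = ?rhs")
proof -
  have E: "place m (f i) A \<in> E m" "place m (g i) B \<in> E m" if "i \<in> I" for i
    using f[OF that] g[OF that] A B by (auto intro!: place_in_E)
  have "?lhs = (\<Sum>i\<in>I. place n G (endo_scale (c i) (place m (f i) A \<circ> place m (g i) B)))"
    using G E by (intro place_sum) (auto intro!: E_scale E_comp)
  also have "\<dots> = ?rhs"
  proof (rule sum.cong[OF refl])
    fix i assume i: "i \<in> I"
    have "place n G (endo_scale (c i) (place m (f i) A \<circ> place m (g i) B))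
      = endo_scale (c i) (place n G (place m (f i) A) \<circ> place n G (place m (g i) B))"
      using G E[OF i] by (simp add: place_scale place_comp E_comp del: o_apply)
    then show "place n G (endo_scale (c i) (place m (f i) A \<circ> place m (g i) B))
      = endo_scale (c i) (place n (pick (f i) G) A \<circ> place n (pick (g i) G) B)"
      using f[OF i] g[OF i] G A B place_place[of A "f i" n G] place_place[of B "g i" n G] by simp
  qed
  finally show ?thesis .
qed

lemma cnorm_left_sum:
  assumes n: "n > 0" and X: "\<And>i. i \<in> I \<Longrightarrow> X i \<in> E n" and Z: "Z \<in> E n"
  shows "cnorm n ((\<Sum>i\<in>I. endo_scale (c i) (X i)) \<circ> Z) = (\<Sum>i\<in>I. endo_scale (c i) (cnorm n (X i \<circ> Z)))"
  using assms by (simp add: comp_sum_left comp_scale_left cnorm_sum cnorm_scale E_comp E_scale)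

lemma cnorm_right_sum:
  assumes n: "n > 0" and X: "\<And>i. i \<in> I \<Longrightarrow> X i \<in> E n" and Z: "Z \<in> E n"
  shows "cnorm n (Z \<circ> (\<Sum>i\<in>I. endo_scale (c i) (X i))) = (\<Sum>i\<in>I. endo_scale (c i) (cnorm n (Z \<circ> X i)))"
  using assms by (simp add: comp_sum_right[OF Z] comp_scale_right[OF Z] cnorm_sum cnorm_scale E_comp E_scale)

definition triple :: "nat \<Rightarrow> nat list \<Rightarrow> nat list \<Rightarrow> nat list \<Rightarrow>
    ('v, 'k) tensor_endo \<Rightarrow> ('v, 'k) tensor_endo \<Rightarrow> ('v, 'k) tensor_endo \<Rightarrow> ('v, 'k) tensor_endo"
  where "triple n f g h A B C = cnorm n (place n f A \<circ> place n g B \<circ> place n h C)"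

lemma triple_shift:
  assumes "A \<in> E (length f)" "B \<in> E (length g)" "C \<in> E (length h)"
    and "slots n f" "slots n g" "slots n h" and n: "n = d + 1"
  shows "triple n f g h A B C =
    endo_scale ((-1) ^ (d * k)) (triple n (shift n k f) (shift n k g) (shift n k h) A B C)"
proof -
  let ?X = "place n f A \<circ> place n g B \<circ> place n h C"
  have E: "place n f A \<in> E n" "place n g B \<in> E n" "place n h C \<in> E n"
    using assms by (auto intro: place_in_E)
  have "(rot n ^^ k) ?X = place n (shift n k f) A \<circ> place n (shift n k g) B \<circ> place n (shift n k h) C"
    using assms E by (simp add: rot_pow_comp rot_pow_place E_comp del: o_apply)
  then have "triple n (shift n k f) (shift n k g) (shift n k h) A B C = cnorm n ((rot n ^^ k) ?X)"
    by (simp add: triple_def)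
  also have "\<dots> = endo_scale ((-1) ^ (d * k)) (cnorm n ?X)"
    using cnorm_rot_pow[of n ?X k] E n by (simp add: E_comp)
  finally show ?thesis
    by (simp add: triple_def power_add[symmetric] mult_2[symmetric])
qed

text \<open>The three families of configurations of polygons \<open>A\<close>, \<open>B\<close>, \<open>C\<close>, named after the polygon that
  shares a vertex with each of the other two. In the first, \<open>C\<close> meets \<open>A\<close> in the last vertex
  \<open>a + b\<close> and \<open>B\<close> meets \<open>A\<close> in \<open>u < a\<close>; in the third, \<open>A\<close> meets \<open>C\<close> in \<open>a\<close> and \<open>B\<close> meets \<open>C\<close> in
  \<open>a + (t + 1) + b\<close>. In the second, the summand \<open>t = b\<close> has all three polygons meeting in one vertex;
  it occurs in both ways of bracketing.\<close>

definition first_meets_both where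
  "first_meets_both a b c A B C = (\<Sum>u<a. endo_scale ((-1) ^ (a * b + b * u))
     (triple (a + b + c + 1) ([0..<u + 1] @ [u + b + 1..<a + b + 1]) [u..<u + b + 1] [a + b..<a + b + c + 1] A B C))"

definition second_meets_both where
  "second_meets_both a b c A B C = (\<Sum>t\<le>b. endo_scale ((-1) ^ (a * t))
     (triple (a + b + c + 1) [t..<t + a + 1] ([0..<t] @ [t + a..<a + b + 1]) [a + b..<a + b + c + 1] A B C))"

definition third_meets_both where
  "third_meets_both a b c A B C = (\<Sum>t<c. endo_scale ((-1) ^ (b * (t + 1)))
     (triple (a + b + c + 1) [0..<a + 1] [a + (t + 1)..<a + (t + 1) + b + 1]
        ([a..<a + (t + 1)] @ [a + (t + 1) + b..<a + b + c + 1]) A B C))"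

text \<open>\<open>C\<close> is attached at position \<open>a + b\<close>. In the expansion of \<open>A \<box> B\<close> that position belongs to \<open>A\<close>
  alone in the first sum and to \<open>B\<close> in the second.\<close>

lemma square_square_left:
  assumes A: "A \<in> CdL s a" and B: "B \<in> CdL s b" and C: "C \<in> CdL s c" and d: "d = a + b"
  shows "square s d c (square s a b A B) C =
    first_meets_both a b c A B C + second_meets_both a b c A B C"
proof -
  define n where "n = a + b + c + 1"
  define m where "m = a + b + 1"
  note AE = CdL_E[OF A] and BE = CdL_E[OF B] and CE = CdL_E[OF C]
  have nm: "n > 0" "m \<le> n" by (simp_all add: n_def m_def)
  let ?Z = "place n [a + b..<n] C"
  let ?f = "\<lambda>u. [0..<u + 1] @ [u + b + 1..<m]" and ?g = "\<lambda>u. [u..<u + b + 1]"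
  let ?h = "\<lambda>t. [t..<t + a + 1]" and ?k = "\<lambda>t. [0..<t] @ [t + a..<m]"
  have pk: "pick f [0..<m] = f" if "slots m f" for f
    using pick_upt[OF that, of 0] map_idI[of f "(+) 0"] by simp
  have Z: "?Z \<in> E n" using CE by (intro place_in_E) (auto simp: n_def)
  have fg: "slots m (?f u) \<and> length (?f u) = a + 1" "slots m (?g u) \<and> length (?g u) = b + 1"
    if "u \<in> {..<a}" for u
    using that by (auto simp: m_def disjoint_iff)
  have hk: "slots m (?h t) \<and> length (?h t) = a + 1" "slots m (?k t) \<and> length (?k t) = b + 1"
    if "t \<in> {..b}" for t
    using that by (auto simp: m_def disjoint_iff)
  have G: "slots n [0..<m]" "length [0..<m] = m" using nm by auto
  have mono: "slots n f" if "slots m f" for f using that nm by (auto simp: slots_def)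
  have Efg: "place n (?f u) A \<circ> place n (?g u) B \<in> E n" if "u \<in> {..<a}" for u
    using fg[OF that] AE BE mono by (intro E_comp place_in_E) (auto simp del: slots_append slots_upt)
  have Ehk: "place n (?h t) A \<circ> place n (?k t) B \<in> E n" if "t \<in> {..b}" for t
    using hk[OF that] AE BE mono by (intro E_comp place_in_E) (auto simp del: slots_append slots_upt)
  have E1: "(\<Sum>u<a. endo_scale ((-1) ^ (a * b + b * u)) (place m (?f u) A \<circ> place m (?g u) B)) \<in> E m"
    using fg AE BE by (intro E_sum E_scale E_comp place_in_E) auto
  have E2: "(\<Sum>t\<le>b. endo_scale ((-1) ^ (a * t)) (place m (?h t) A \<circ> place m (?k t) B)) \<in> E m"
    using hk AE BE by (intro E_sum E_scale E_comp place_in_E) auto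
  have F1: "(\<Sum>u<a. endo_scale ((-1) ^ (a * b + b * u)) (place n (?f u) A \<circ> place n (?g u) B)) \<in> E n"
    using Efg by (intro E_sum E_scale)
  have F2: "(\<Sum>t\<le>b. endo_scale ((-1) ^ (a * t)) (place n (?h t) A \<circ> place n (?k t) B)) \<in> E n"
    using Ehk by (intro E_sum E_scale)
  have "place n [0..<m] (square s a b A B) =
    place n [0..<m] (\<Sum>u<a. endo_scale ((-1) ^ (a * b + b * u)) (place m (?f u) A \<circ> place m (?g u) B)) +
    place n [0..<m] (\<Sum>t\<le>b. endo_scale ((-1) ^ (a * t)) (place m (?h t) A \<circ> place m (?k t) B))"
    unfolding square_expand[OF A B m_def] using E1 E2 G by (intro place_add) auto
  also have "\<dots> = (\<Sum>u<a. endo_scale ((-1) ^ (a * b + b * u)) (place n (?f u) A \<circ> place n (?g u) B)) +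
    (\<Sum>t\<le>b. endo_scale ((-1) ^ (a * t)) (place n (?h t) A \<circ> place n (?k t) B))"
    using fg hk
    by (simp only: place_comp_sum[OF G AE BE fg] place_comp_sum[OF G AE BE hk])
      (intro arg_cong2[where f = "(+)"] sum.cong refl; simp add: pk)
  finally have pl: "place n [0..<m] (square s a b A B) = \<dots>" .
  have "square s d c (square s a b A B) C = cnorm n (place n [0..<m] (square s a b A B) \<circ> ?Z)"
    using square_in_E[OF A B] CE d by (simp add: square_eq_cnorm diamond_eq n_def m_def)
  also have "\<dots> = (\<Sum>u<a. endo_scale ((-1) ^ (a * b + b * u)) (cnorm n (place n (?f u) A \<circ> place n (?g u) B \<circ> ?Z))) +
    (\<Sum>t\<le>b. endo_scale ((-1) ^ (a * t)) (cnorm n (place n (?h t) A \<circ> place n (?k t) B \<circ> ?Z)))"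
    unfolding pl comp_add_left cnorm_add[OF nm(1) E_comp[OF F1 Z] E_comp[OF F2 Z]]
    by (intro arg_cong2[where f = "(+)"] cnorm_left_sum nm(1) Z Efg Ehk)
  finally show ?thesis
    unfolding first_meets_both_def second_meets_both_def triple_def n_def m_def .
qed

text \<open>Here \<open>A\<close> is attached at position \<open>a\<close>, which belongs to \<open>B\<close> in the first sum; in the second sum it
  belongs to \<open>C\<close> alone, except for \<open>t = 0\<close>.\<close>

lemma square_square_right_expand:
  assumes A: "A \<in> CdL s a" and B: "B \<in> CdL s b" and C: "C \<in> CdL s c"
    and d: "d = b + c" and n: "n = a + b + c + 1"
  shows "square s a d A (square s b c B C) =
    (\<Sum>u<b. endo_scale ((-1) ^ (b * c + c * u))
       (triple n [0..<a + 1] ([a..<a + u + 1] @ [a + u + c + 1..<n]) [a + u..<a + u + c + 1] A B C)) +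
    (\<Sum>t\<le>c. endo_scale ((-1) ^ (b * t))
       (triple n [0..<a + 1] [a + t..<a + t + b + 1] ([a..<a + t] @ [a + t + b..<n]) A B C))"
proof -
  define m where "m = b + c + 1"
  note AE = CdL_E[OF A] and BE = CdL_E[OF B] and CE = CdL_E[OF C]
  have nm: "n > 0" "n = a + m" by (simp_all add: n m_def)
  let ?Z = "place n [0..<a + 1] A" and ?G = "[a..<a + m]"
  let ?f = "\<lambda>u. [0..<u + 1] @ [u + c + 1..<m]" and ?g = "\<lambda>u. [u..<u + c + 1]"
  let ?h = "\<lambda>t. [t..<t + b + 1]" and ?k = "\<lambda>t. [0..<t] @ [t + b..<m]"
  let ?f' = "\<lambda>u. [a..<a + u + 1] @ [a + u + c + 1..<n]" and ?g' = "\<lambda>u. [a + u..<a + u + c + 1]"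
  let ?h' = "\<lambda>t. [a + t..<a + t + b + 1]" and ?k' = "\<lambda>t. [a..<a + t] @ [a + t + b..<n]"
  have Z: "?Z \<in> E n" using AE by (intro place_in_E) (auto simp: n)
  have fg: "slots m (?f u) \<and> length (?f u) = b + 1" "slots m (?g u) \<and> length (?g u) = c + 1"
    if "u \<in> {..<b}" for u
    using that by (auto simp: m_def disjoint_iff)
  have hk: "slots m (?h t) \<and> length (?h t) = b + 1" "slots m (?k t) \<and> length (?k t) = c + 1"
    if "t \<in> {..c}" for t
    using that by (auto simp: m_def disjoint_iff)
  have fg': "slots n (?f' u) \<and> length (?f' u) = b + 1" "slots n (?g' u) \<and> length (?g' u) = c + 1"
    if "u \<in> {..<b}" for u
    using that by (auto simp: n disjoint_iff)
  have hk': "slots n (?h' t) \<and> length (?h' t) = b + 1" "slots n (?k' t) \<and> length (?k' t) = c + 1"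
    if "t \<in> {..c}" for t
    using that by (auto simp: n disjoint_iff)
  have pk: "pick (?f u) ?G = ?f' u" "pick (?g u) ?G = ?g' u" if "u \<in> {..<b}" for u
    using fg[OF that] nm(2) by (auto simp: pick_upt map_plus_upt add.assoc simp del: slots_append)
  have pk': "pick (?h t) ?G = ?h' t" "pick (?k t) ?G = ?k' t" if "t \<in> {..c}" for t
    using hk[OF that] nm(2) by (auto simp: pick_upt map_plus_upt add.assoc simp del: slots_append)
  have G: "slots n ?G" "length ?G = m" using nm by auto
  have Efg: "place n (?f' u) B \<circ> place n (?g' u) C \<in> E n" if "u \<in> {..<b}" for u
    using fg'[OF that] BE CE by (intro E_comp place_in_E) auto
  have Ehk: "place n (?h' t) B \<circ> place n (?k' t) C \<in> E n" if "t \<in> {..c}" for t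
    using hk'[OF that] BE CE by (intro E_comp place_in_E) auto
  have E1: "(\<Sum>u<b. endo_scale ((-1) ^ (b * c + c * u)) (place m (?f u) B \<circ> place m (?g u) C)) \<in> E m"
    using fg CE BE by (intro E_sum E_scale E_comp place_in_E) auto
  have E2: "(\<Sum>t\<le>c. endo_scale ((-1) ^ (b * t)) (place m (?h t) B \<circ> place m (?k t) C)) \<in> E m"
    using hk CE BE by (intro E_sum E_scale E_comp place_in_E) auto
  have F1: "(\<Sum>u<b. endo_scale ((-1) ^ (b * c + c * u)) (place n (?f' u) B \<circ> place n (?g' u) C)) \<in> E n"
    using Efg by (intro E_sum E_scale)
  have F2: "(\<Sum>t\<le>c. endo_scale ((-1) ^ (b * t)) (place n (?h' t) B \<circ> place n (?k' t) C)) \<in> E n"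
    using Ehk by (intro E_sum E_scale)
  have "place n ?G (square s b c B C) =
    place n ?G (\<Sum>u<b. endo_scale ((-1) ^ (b * c + c * u)) (place m (?f u) B \<circ> place m (?g u) C)) +
    place n ?G (\<Sum>t\<le>c. endo_scale ((-1) ^ (b * t)) (place m (?h t) B \<circ> place m (?k t) C))"
    unfolding square_expand[OF B C m_def] using E1 E2 G by (intro place_add) auto
  also have "\<dots> = (\<Sum>u<b. endo_scale ((-1) ^ (b * c + c * u)) (place n (?f' u) B \<circ> place n (?g' u) C)) +
    (\<Sum>t\<le>c. endo_scale ((-1) ^ (b * t)) (place n (?h' t) B \<circ> place n (?k' t) C))"
    using fg hk
    by (simp only: place_comp_sum[OF G BE CE fg] place_comp_sum[OF G BE CE hk])
      (intro arg_cong2[where f = "(+)"] sum.cong refl; simp only: pk pk')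
  finally have pl: "place n ?G (square s b c B C) = \<dots>" .
  have "square s a d A (square s b c B C) = cnorm n (?Z \<circ> place n ?G (square s b c B C))"
    using square_in_E[OF B C] AE d by (simp add: square_eq_cnorm diamond_eq n m_def add.assoc)
  also have "\<dots> = (\<Sum>u<b. endo_scale ((-1) ^ (b * c + c * u)) (cnorm n (?Z \<circ> (place n (?f' u) B \<circ> place n (?g' u) C)))) +
    (\<Sum>t\<le>c. endo_scale ((-1) ^ (b * t)) (cnorm n (?Z \<circ> (place n (?h' t) B \<circ> place n (?k' t) C))))"
    unfolding pl comp_add_right[OF Z F1 F2] cnorm_add[OF nm(1) E_comp[OF Z F1] E_comp[OF Z F2]]
    by (intro arg_cong2[where f = "(+)"] cnorm_right_sum nm(1) Z Efg Ehk)
  finally show ?thesis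
    unfolding triple_def o_assoc .
qed

lemma triple_rotate:
  assumes "slots n h" "slots n g" "slots n f"
  shows "A \<in> CdL s a \<Longrightarrow> length f = a + 1 \<Longrightarrow> B \<in> E (length g) \<Longrightarrow> C \<in> E (length h) \<Longrightarrow>
      triple n (rotate k f) g h A B C = endo_scale ((-1) ^ (a * k)) (triple n f g h A B C)"
    and "B \<in> CdL s b \<Longrightarrow> length g = b + 1 \<Longrightarrow> A \<in> E (length f) \<Longrightarrow> C \<in> E (length h) \<Longrightarrow>
      triple n f (rotate k g) h A B C = endo_scale ((-1) ^ (b * k)) (triple n f g h A B C)"
    and "C \<in> CdL s c \<Longrightarrow> length h = c + 1 \<Longrightarrow> A \<in> E (length f) \<Longrightarrow> B \<in> E (length g) \<Longrightarrow>
      triple n f g (rotate k h) A B C = endo_scale ((-1) ^ (c * k)) (triple n f g h A B C)"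
proof -
  have n: "n > 0" if "length f > 0" "slots n f" for f
    using that by (cases f) (auto simp: slots_def)
  show "triple n (rotate k f) g h A B C = endo_scale ((-1) ^ (a * k)) (triple n f g h A B C)"
    if "A \<in> CdL s a" "length f = a + 1" "B \<in> E (length g)" "C \<in> E (length h)"
    using that assms CdL_E[OF that(1)] n[of f]
    by (simp add: triple_def place_rotate comp_scale_left cnorm_scale E_comp place_in_E del: o_apply)
  show "triple n f (rotate k g) h A B C = endo_scale ((-1) ^ (b * k)) (triple n f g h A B C)"
    if "B \<in> CdL s b" "length g = b + 1" "A \<in> E (length f)" "C \<in> E (length h)"
    using that assms CdL_E[OF that(1)] n[of g] comp_scale_right[of "place n f A" n "place n g B"]
    by (simp add: triple_def place_rotate comp_scale_left cnorm_scale E_comp place_in_E del: o_apply)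
  show "triple n f g (rotate k h) A B C = endo_scale ((-1) ^ (c * k)) (triple n f g h A B C)"
    if "C \<in> CdL s c" "length h = c + 1" "A \<in> E (length f)" "B \<in> E (length g)"
    using that assms CdL_E[OF that(1)] n[of h] comp_scale_right[of "place n f A \<circ> place n g B" n "place n h C"]
    by (simp add: triple_def place_rotate cnorm_scale E_comp place_in_E del: o_apply)
qed

text \<open>The summand \<open>t = 0\<close> of the second sum above continues the first sum to \<open>u = b\<close>. After this
  regrouping, the summand \<open>u = b - t\<close> of the first sum is rotated by \<open>t\<close>, which moves \<open>A\<close> from \<open>0\<close> to
  \<open>t\<close> and gives the summand \<open>t\<close> of \<open>second_meets_both\<close>.\<close>

lemma square_square_right:
  assumes A: "A \<in> CdL s a" and B: "B \<in> CdL s b" and C: "C \<in> CdL s c" and d: "d = b + c"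
  shows "square s a d A (square s b c B C) =
    second_meets_both a b c A B C + third_meets_both a b c A B C"
proof -
  define n where "n = a + b + c + 1"
  note AE = CdL_E[OF A] and BE = CdL_E[OF B] and CE = CdL_E[OF C]
  let ?X = "\<lambda>u. endo_scale ((-1) ^ (b * c + c * u))
       (triple n [0..<a + 1] ([a..<a + u + 1] @ [a + u + c + 1..<n]) [a + u..<a + u + c + 1] A B C)"
  let ?Y = "\<lambda>t. endo_scale ((-1) ^ (b * t))
       (triple n [0..<a + 1] [a + t..<a + t + b + 1] ([a..<a + t] @ [a + t + b..<n]) A B C)"
  let ?M = "\<lambda>t. endo_scale ((-1) ^ (a * t))
     (triple n [t..<t + a + 1] ([0..<t] @ [t + a..<a + b + 1]) [a + b..<n] A B C)"
  have Y: "(\<Sum>t\<le>c. ?Y t) = ?Y 0 + (\<Sum>t<c. ?Y (t + 1))"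
    by (simp add: sum.atMost_shift)
  have "?Y 0 = ?X b"
    by (simp add: n_def mult.commute[of c b] mult_2[symmetric] power_add[symmetric])
  then have "(\<Sum>u<b. ?X u) + ?Y 0 = (\<Sum>u\<le>b. ?X u)"
    by (simp add: lessThan_Suc_atMost[symmetric])
  also have "\<dots> = (\<Sum>t\<le>b. ?X (b - t))"
    by (rule sum.reindex_bij_witness[of _ "\<lambda>t. b - t" "\<lambda>t. b - t"]) auto
  also have "\<dots> = (\<Sum>t\<le>b. ?M t)"
  proof (rule sum.cong[OF refl])
    fix t assume "t \<in> {..b}"
    then obtain u where b: "b = u + t" using le_iff_add[of t b] by (auto simp: add.commute)
    have n': "n = (a + b + c) + 1" by (simp add: n_def)
    let ?f = "[0..<a + 1]" and ?g = "[a..<a + u + 1] @ [a + u + c + 1..<n]" and ?h = "[a + u..<a + u + c + 1]"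
    have sf: "shift n t ?f = [t..<t + a + 1]"
      by (simp add: shift_upt n_def b add_ac)
    have "shift n t ?g = [t + a..<a + b + 1] @ [0..<t]"
      by (simp add: shift_append shift_upt shift_upt_wrap n_def b add_ac)
    also have "\<dots> = rotate t ([0..<t] @ [t + a..<a + b + 1])"
      by (rule rotate_append_length) simp
    finally have sg: "shift n t ?g = \<dots>" .
    have sh: "shift n t ?h = [a + b..<n]"
      by (simp add: shift_upt n_def b add_ac)
    have "triple n ?f ?g ?h A B C = endo_scale ((-1) ^ ((a + b + c) * t))
        (triple n (shift n t ?f) (shift n t ?g) (shift n t ?h) A B C)"
      by (rule triple_shift) (use AE BE CE in \<open>auto simp: n_def b disjoint_iff add_ac\<close>)
    also have "triple n (shift n t ?f) (shift n t ?g) (shift n t ?h) A B C = endo_scale ((-1) ^ (b * t))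
        (triple n [t..<t + a + 1] ([0..<t] @ [t + a..<a + b + 1]) [a + b..<n] A B C)"
      unfolding sf sg sh
      by (rule triple_rotate(2)) (use AE B CE in \<open>auto simp: n_def b disjoint_iff add_ac\<close>)
    finally have eq: "triple n ?f ?g ?h A B C = endo_scale ((-1) ^ ((a + b + c) * t)) (endo_scale ((-1) ^ (b * t))
        (triple n [t..<t + a + 1] ([0..<t] @ [t + a..<a + b + 1]) [a + b..<n] A B C))" .
    have sgn: "(-1 :: 'k) ^ (b * c + c * u) * (-1) ^ ((a + b + c) * t) * (-1) ^ (b * t) = (-1) ^ (a * t)"
      unfolding power_add[symmetric] by (rule neg_one_power_cong) (auto simp: b)
    have bt: "b - t = u" using b by simp
    show "?X (b - t) = ?M t"
      unfolding bt eq EV.scale_scale by (simp only: sgn mult.assoc[symmetric])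
  qed
  finally have M: "(\<Sum>u<b. ?X u) + ?Y 0 = second_meets_both a b c A B C"
    by (simp add: second_meets_both_def n_def)
  have "square s a d A (square s b c B C) = (\<Sum>u<b. ?X u) + (\<Sum>t\<le>c. ?Y t)"
    by (rule square_square_right_expand[OF A B C d n_def])
  also have "\<dots> = second_meets_both a b c A B C + (\<Sum>t<c. ?Y (t + 1))"
    unfolding Y M[symmetric] by (simp only: add.assoc)
  also have "(\<Sum>t<c. ?Y (t + 1)) = third_meets_both a b c A B C"
    by (simp only: third_meets_both_def n_def)
  finally show ?thesis .
qed

text \<open>Rotating by \<open>b + 1 + u\<close> brings \<open>C\<close> from vertex \<open>v = a - 1 - u\<close> of \<open>A\<close> to the last vertex and \<open>B\<close> from the
  last vertex to vertex \<open>u\<close>. The two then act on disjoint factors and can be exchanged.\<close>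

lemma first_meets_both_commute:
  assumes A: "A \<in> CdL s a" and B: "B \<in> CdL s b" and C: "C \<in> CdL s c"
  shows "first_meets_both a c b A C B = endo_scale ((-1) ^ (b * c)) (first_meets_both a b c A B C)"
proof -
  define n where "n = a + b + c + 1"
  note AE = CdL_E[OF A] and BE = CdL_E[OF B] and CE = CdL_E[OF C]
  let ?X = "\<lambda>v. endo_scale ((-1) ^ (a * c + c * v))
     (triple n ([0..<v + 1] @ [v + c + 1..<a + c + 1]) [v..<v + c + 1] [a + c..<n] A C B)"
  let ?Y = "\<lambda>u. endo_scale ((-1) ^ (a * b + b * u))
     (triple n ([0..<u + 1] @ [u + b + 1..<a + b + 1]) [u..<u + b + 1] [a + b..<n] A B C)"
  have "first_meets_both a c b A C B = (\<Sum>v<a. ?X v)"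
    by (simp add: first_meets_both_def n_def add_ac)
  also have "\<dots> = (\<Sum>u<a. ?X (a - Suc u))"
    by (rule sum.nat_diff_reindex[symmetric])
  also have "\<dots> = (\<Sum>u<a. endo_scale ((-1) ^ (b * c)) (?Y u))"
  proof (rule sum.cong[OF refl])
    fix u assume "u \<in> {..<a}"
    then obtain v where a: "a = Suc (u + v)" by (auto dest: less_imp_Suc_add)
    have av: "a - Suc u = v" using a by simp
    let ?k = "b + 1 + u"
    let ?f = "[0..<v + 1] @ [v + c + 1..<a + c + 1]" and ?h = "[v..<v + c + 1]" and ?g = "[a + c..<n]"
    let ?f' = "[0..<u + 1] @ [u + b + 1..<a + b + 1]" and ?g' = "[u..<u + b + 1]" and ?h' = "[a + b..<n]"
    have "shift n ?k ?f = [u + b + 1..<a + b + 1] @ [0..<u + 1]"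
      by (simp add: shift_append shift_upt shift_upt_wrap n_def a add_ac)
    also have "\<dots> = rotate (u + 1) ?f'"
      by (rule rotate_append_length) simp
    finally have sf: "shift n ?k ?f = \<dots>" .
    have sh: "shift n ?k ?h = ?h'"
      by (simp add: shift_upt n_def a add_ac)
    have sg: "shift n ?k ?g = ?g'"
      by (simp add: shift_upt_wrap n_def a add_ac)
    have "triple n ?f ?h ?g A C B = endo_scale ((-1) ^ ((a + b + c) * ?k))
        (triple n (shift n ?k ?f) (shift n ?k ?h) (shift n ?k ?g) A C B)"
      by (rule triple_shift) (use AE BE CE in \<open>auto simp: n_def a disjoint_iff add_ac\<close>)
    also have "triple n (shift n ?k ?f) (shift n ?k ?h) (shift n ?k ?g) A C B
        = endo_scale ((-1) ^ (a * (u + 1))) (triple n ?f' ?h' ?g' A C B)"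
      unfolding sf sg sh
      by (rule triple_rotate(1)) (use A BE CE in \<open>auto simp: n_def a disjoint_iff add_ac\<close>)
    also have "triple n ?f' ?h' ?g' A C B = triple n ?f' ?g' ?h' A B C"
    proof -
      have "place n ?h' C \<circ> place n ?g' B = place n ?g' B \<circ> place n ?h' C"
        by (rule place_commute) (use BE CE in \<open>auto simp: n_def a\<close>)
      then show ?thesis by (simp only: triple_def o_assoc[symmetric])
    qed
    finally have eq: "triple n ?f ?h ?g A C B = endo_scale ((-1) ^ ((a + b + c) * ?k))
        (endo_scale ((-1) ^ (a * (u + 1))) (triple n ?f' ?g' ?h' A B C))" .
    have sgn: "(-1 :: 'k) ^ (a * c + c * v) * (-1) ^ ((a + b + c) * ?k) * (-1) ^ (a * (u + 1))
        = (-1) ^ (b * c) * (-1) ^ (a * b + b * u)"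
      unfolding power_add[symmetric] by (rule neg_one_power_cong) (auto simp: a)
    show "?X (a - Suc u) = endo_scale ((-1) ^ (b * c)) (?Y u)"
      unfolding av eq EV.scale_scale by (simp only: sgn mult.assoc[symmetric])
  qed
  finally show ?thesis
    by (simp add: first_meets_both_def n_def EV.scale_sum_right)
qed

text \<open>Rotating by \<open>a + (t + 1)\<close> brings \<open>A\<close> to the positions from \<open>0\<close> on and \<open>B\<close>, which occupied those,
  to its place in the summand \<open>t\<close>. The two act on disjoint factors and can be exchanged.\<close>

lemma third_meets_both_commute:
  assumes A: "A \<in> CdL s a" and B: "B \<in> CdL s b" and C: "C \<in> CdL s c"
  shows "third_meets_both b a c B A C = endo_scale ((-1) ^ (a * b)) (third_meets_both a b c A B C)"
proof -
  define n where "n = a + b + c + 1"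
  note AE = CdL_E[OF A] and BE = CdL_E[OF B] and CE = CdL_E[OF C]
  let ?X = "\<lambda>v. endo_scale ((-1) ^ (a * (v + 1)))
     (triple n [0..<b + 1] [b + (v + 1)..<b + (v + 1) + a + 1] ([b..<b + (v + 1)] @ [b + (v + 1) + a..<n]) B A C)"
  let ?Y = "\<lambda>t. endo_scale ((-1) ^ (b * (t + 1)))
     (triple n [0..<a + 1] [a + (t + 1)..<a + (t + 1) + b + 1] ([a..<a + (t + 1)] @ [a + (t + 1) + b..<n]) A B C)"
  have "third_meets_both b a c B A C = (\<Sum>v<c. ?X v)"
    by (simp add: third_meets_both_def n_def add.commute[of b a])
  also have "\<dots> = (\<Sum>t<c. ?X (c - Suc t))"
    by (rule sum.nat_diff_reindex[symmetric])
  also have "\<dots> = (\<Sum>t<c. endo_scale ((-1) ^ (a * b)) (?Y t))"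
  proof (rule sum.cong[OF refl])
    fix t assume "t \<in> {..<c}"
    then obtain v where c: "c = Suc (t + v)" by (auto dest: less_imp_Suc_add)
    have cv: "c - Suc t = v" using c by simp
    let ?k = "a + (t + 1)"
    let ?g = "[0..<b + 1]" and ?f = "[b + (v + 1)..<b + (v + 1) + a + 1]"
      and ?h = "[b..<b + (v + 1)] @ [b + (v + 1) + a..<n]"
    let ?f' = "[0..<a + 1]" and ?g' = "[a + (t + 1)..<a + (t + 1) + b + 1]"
      and ?h' = "[a..<a + (t + 1)] @ [a + (t + 1) + b..<n]"
    have "shift n ?k ?h = [a + (t + 1) + b..<n] @ [a..<a + (t + 1)]"
      by (simp add: shift_append shift_upt shift_upt_wrap n_def c add_ac)
    also have "\<dots> = rotate (t + 1) ?h'"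
      by (rule rotate_append_length) simp
    finally have sh: "shift n ?k ?h = \<dots>" .
    have sg: "shift n ?k ?g = ?g'"
      by (simp add: shift_upt n_def c add_ac)
    have sf: "shift n ?k ?f = ?f'"
      by (simp add: shift_upt_wrap n_def c add_ac)
    have "triple n ?g ?f ?h B A C = endo_scale ((-1) ^ ((a + b + c) * ?k))
        (triple n (shift n ?k ?g) (shift n ?k ?f) (shift n ?k ?h) B A C)"
      by (rule triple_shift) (use AE BE CE in \<open>auto simp: n_def c disjoint_iff add_ac\<close>)
    also have "triple n (shift n ?k ?g) (shift n ?k ?f) (shift n ?k ?h) B A C
        = endo_scale ((-1) ^ (c * (t + 1))) (triple n ?g' ?f' ?h' B A C)"
      unfolding sf sg sh
      by (rule triple_rotate(3)) (use C AE BE in \<open>auto simp: n_def c disjoint_iff add_ac\<close>)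
    also have "triple n ?g' ?f' ?h' B A C = triple n ?f' ?g' ?h' A B C"
    proof -
      have "place n ?g' B \<circ> place n ?f' A = place n ?f' A \<circ> place n ?g' B"
        by (rule place_commute) (use AE BE in \<open>auto simp: n_def c\<close>)
      then show ?thesis by (simp only: triple_def)
    qed
    finally have eq: "triple n ?g ?f ?h B A C = endo_scale ((-1) ^ ((a + b + c) * ?k))
        (endo_scale ((-1) ^ (c * (t + 1))) (triple n ?f' ?g' ?h' A B C))" .
    have sgn: "(-1 :: 'k) ^ (a * (v + 1)) * (-1) ^ ((a + b + c) * ?k) * (-1) ^ (c * (t + 1))
        = (-1) ^ (a * b) * (-1) ^ (b * (t + 1))"
      unfolding power_add[symmetric] by (rule neg_one_power_cong) (auto simp: c)
    show "?X (c - Suc t) = endo_scale ((-1) ^ (a * b)) (?Y t)"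
      unfolding cv eq EV.scale_scale by (simp only: sgn mult.assoc[symmetric])
  qed
  finally show ?thesis
    by (simp add: third_meets_both_def n_def EV.scale_sum_right)
qed

section \<open>The bracket on homogeneous elements\<close>


lemma subspace_CdL: "EV.subspace (CdL s p)"
  by (rule EV.subspaceI)
    (auto simp: CdL_iff E_zero E_add E_scale rot_zero rot_add rot_scale EV.scale_right_distrib mult.commute)

lemmas CdL_zero = EV.subspace_0[OF subspace_CdL]
  and CdL_add = EV.subspace_add[OF subspace_CdL]
  and CdL_scale = EV.subspace_scale[OF subspace_CdL]
  and CdL_diff = EV.subspace_diff[OF subspace_CdL]
  and CdL_sum_in = EV.subspace_sum[OF subspace_CdL]

lemma square_add_left:
  assumes "P \<in> E (p + 1)" "P' \<in> E (p + 1)" "Q \<in> E (q + 1)"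
  shows "square s p q (P + P') Q = square s p q P Q + square s p q P' Q"
  using assms
  by (simp add: square_eq_cnorm diamond_eq E_add place_add comp_add_left cnorm_add E_comp place_in_E del: o_apply)

lemma square_add_right:
  assumes "P \<in> E (p + 1)" "Q \<in> E (q + 1)" "Q' \<in> E (q + 1)"
  shows "square s p q P (Q + Q') = square s p q P Q + square s p q P Q'"
  using assms comp_add_right[of "place (p + q + 1) [0..<p + 1] P" "p + q + 1"
      "place (p + q + 1) [p..<p + q + 1] Q" "place (p + q + 1) [p..<p + q + 1] Q'"]
  by (simp add: square_eq_cnorm diamond_eq E_add place_add cnorm_add E_comp place_in_E del: o_apply)

lemma square_scale_left:
  assumes "P \<in> E (p + 1)" "Q \<in> E (q + 1)"
  shows "square s p q (endo_scale c P) Q = endo_scale c (square s p q P Q)"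
  using assms
  by (simp add: square_eq_cnorm diamond_eq E_scale place_scale comp_scale_left cnorm_scale E_comp place_in_E del: o_apply)

lemma square_scale_right:
  assumes "P \<in> E (p + 1)" "Q \<in> E (q + 1)"
  shows "square s p q P (endo_scale c Q) = endo_scale c (square s p q P Q)"
  using assms comp_scale_right[of "place (p + q + 1) [0..<p + 1] P" "p + q + 1"
      "place (p + q + 1) [p..<p + q + 1] Q" c]
  by (simp add: square_eq_cnorm diamond_eq E_scale place_scale cnorm_scale E_comp place_in_E del: o_apply)

lemma square_diff_scale:
  assumes "P \<in> E (p + 1)" "Q \<in> E (q + 1)" "Q' \<in> E (q + 1)"
  shows "square s p q P (Q - endo_scale c Q') = square s p q P Q - endo_scale c (square s p q P Q')"
    and "square s q p (Q - endo_scale c Q') P = square s q p Q P - endo_scale c (square s q p Q' P)"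
proof -
  have m: "X - endo_scale c Y = X + endo_scale (- c) Y" for X Y :: "('v, 'k) tensor_endo"
    by simp
  show "square s p q P (Q - endo_scale c Q') = square s p q P Q - endo_scale c (square s p q P Q')"
    unfolding m using assms by (simp only: square_add_right E_scale square_scale_right)
  show "square s q p (Q - endo_scale c Q') P = square s q p Q P - endo_scale c (square s q p Q' P)"
    unfolding m using assms by (simp only: square_add_left E_scale square_scale_left)
qed

lemma bracket_CdL:
  assumes "P \<in> E (p + 1)" "Q \<in> E (q + 1)"
  shows "bracket_dL s p q P Q \<in> CdL s (p + q)"
  using square_CdL[OF assms] square_CdL[OF assms(2,1)]
  by (simp add: bracket_dL_def CdL_diff CdL_scale add.commute)

lemma bracket_add:
  assumes "P \<in> E (p + 1)" "Q \<in> E (q + 1)"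
  shows "P' \<in> E (p + 1) \<Longrightarrow> bracket_dL s p q (P + P') Q = bracket_dL s p q P Q + bracket_dL s p q P' Q"
    and "Q' \<in> E (q + 1) \<Longrightarrow> bracket_dL s p q P (Q + Q') = bracket_dL s p q P Q + bracket_dL s p q P Q'"
  using assms
  by (simp_all add: bracket_dL_def square_add_left square_add_right EV.scale_right_distrib)

lemma bracket_scale:
  assumes "P \<in> E (p + 1)" "Q \<in> E (q + 1)"
  shows "bracket_dL s p q (endo_scale c P) Q = endo_scale c (bracket_dL s p q P Q)"
    and "bracket_dL s p q P (endo_scale c Q) = endo_scale c (bracket_dL s p q P Q)"
  using assms
  by (simp_all add: bracket_dL_def square_scale_left square_scale_right EV.scale_right_diff_distrib mult.commute)

lemma bracket_zero:
  shows "Q \<in> E (q + 1) \<Longrightarrow> bracket_dL s p q 0 Q = 0"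
    and "P \<in> E (p + 1) \<Longrightarrow> bracket_dL s p q P 0 = 0"
  using bracket_scale(1)[OF E_zero, of Q q p 0] bracket_scale(2)[OF _ E_zero, of P p q 0] by simp_all

lemma bracket_antisymmetric:
  "bracket_dL s p q P Q = - endo_scale ((-1) ^ (p * q)) (bracket_dL s q p Q P)"
  by (cases "even (p * q)") (simp_all add: bracket_dL_def mult.commute[of q p])

lemma bracket_bracket_right:
  assumes P: "P \<in> CdL s p" and Q: "Q \<in> CdL s q" and R: "R \<in> CdL s r"
  shows "bracket_dL s p (q + r) P (bracket_dL s q r Q R) =
      (second_meets_both p q r P Q R + third_meets_both p q r P Q R)
    - endo_scale ((-1) ^ (q * r)) (second_meets_both p r q P R Q + third_meets_both p r q P R Q)
    - endo_scale ((-1) ^ (p * (q + r)))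
       ((first_meets_both q r p Q R P + second_meets_both q r p Q R P)
        - endo_scale ((-1) ^ (q * r)) (first_meets_both r q p R Q P + second_meets_both r q p R Q P))"
proof -
  have E: "P \<in> E (p + 1)" "square s q r Q R \<in> E (q + r + 1)" "square s r q R Q \<in> E (q + r + 1)"
    using CdL_E[OF P] square_in_E[OF Q R] square_in_E[OF R Q] by (simp_all add: add.commute)
  have comm: "q + r = r + q" by simp
  show ?thesis
    unfolding bracket_dL_def square_diff_scale[OF E] square_square_right[OF P Q R refl]
      square_square_right[OF P R Q comm] square_square_left[OF Q R P refl]
      square_square_left[OF R Q P comm] by (rule refl)
qed

text \<open>Antisymmetry makes every nested bracket a right-nested one. After expansion and use of the two
  symmetries, what remains is an identity between formal combinations of twelve terms whose
  coefficients depend only on the parities of the degrees.\<close>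

theorem bracket_jacobi:
  assumes P: "P \<in> CdL s p" and Q: "Q \<in> CdL s q" and R: "R \<in> CdL s r"
  shows "bracket_dL s p (q + r) P (bracket_dL s q r Q R) =
     bracket_dL s (p + q) r (bracket_dL s p q P Q) R
     + endo_scale ((-1) ^ (p * q)) (bracket_dL s q (p + r) Q (bracket_dL s p r P R))"
  unfolding bracket_antisymmetric[of "p + q" r] bracket_bracket_right[OF P Q R]
    bracket_bracket_right[OF Q P R] bracket_bracket_right[OF R P Q]
    first_meets_both_commute[OF P Q R] first_meets_both_commute[OF Q P R] first_meets_both_commute[OF R P Q]
    third_meets_both_commute[OF P Q R] third_meets_both_commute[OF P R Q] third_meets_both_commute[OF Q R P]
  by (cases "even p"; cases "even q"; cases "even r") (simp_all add: algebra_simps)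

section \<open>The graded Lie algebra\<close>

lemma vector_space_family: "vector_space (family_scale :: 'k \<Rightarrow> ('v, 'k) endo_family \<Rightarrow> _)"
  by (intro vector_space_fun_scale vector_space_field)

sublocale FV: vector_space "family_scale :: 'k \<Rightarrow> ('v, 'k) endo_family \<Rightarrow> _"
  by (rule vector_space_family)

definition single :: "nat \<Rightarrow> ('v, 'k) tensor_endo \<Rightarrow> ('v, 'k) endo_family"
  where "single p X = (\<lambda>q. if q = p then X else 0)"

lemma family_pointwise:
  fixes x y :: "('v, 'k) endo_family"
  shows "(x + y) n = x n + y n" "(0 :: ('v, 'k) endo_family) n = 0"
    and "family_scale c x n = endo_scale c (x n)" "(- x) n = - x n"
  by (simp_all add: pointwise fun_scale_def[of endo_scale])

lemma family_sum_apply: "sum x I n = (\<Sum>i\<in>I. x i n)" for x :: "'i \<Rightarrow> ('v, 'k) endo_family"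
  by (induction I rule: infinite_finite_induct) (simp_all add: family_pointwise)

lemma component_iff: "x \<in> CdL_component s p \<longleftrightarrow> (\<exists>X\<in>CdL s p. x = single p X)"
  by (auto simp: CdL_component_def single_def fun_eq_iff[where 'a = nat])

lemma subspace_component: "FV.subspace (CdL_component s p)"
  by (rule FV.subspaceI)
    (auto simp: CdL_component_def family_pointwise CdL_zero CdL_add CdL_scale)

lemma subspace_CdL_sum: "FV.subspace (CdL_sum s)"
proof (rule FV.subspaceI)
  show "0 \<in> CdL_sum s" by (simp add: CdL_sum_def family_pointwise CdL_zero)
next
  fix x y :: "('v, 'k) endo_family" assume xy: "x \<in> CdL_sum s" "y \<in> CdL_sum s"
  have "{n. (x + y) n \<noteq> 0} \<subseteq> {n. x n \<noteq> 0} \<union> {n. y n \<noteq> 0}"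
    by (auto simp: family_pointwise)
  then have "finite {n. (x + y) n \<noteq> 0}"
    by (rule finite_subset) (use xy in \<open>auto simp: CdL_sum_def\<close>)
  then show "x + y \<in> CdL_sum s" using xy by (simp add: CdL_sum_def family_pointwise CdL_add)
next
  fix c and x :: "('v, 'k) endo_family" assume x: "x \<in> CdL_sum s"
  have "{n. family_scale c x n \<noteq> 0} \<subseteq> {n. x n \<noteq> 0}"
    by (auto simp: family_pointwise)
  then have "finite {n. family_scale c x n \<noteq> 0}"
    by (rule finite_subset) (use x in \<open>auto simp: CdL_sum_def\<close>)
  then show "family_scale c x \<in> CdL_sum s" using x by (simp add: CdL_sum_def family_pointwise CdL_scale)
qed

lemma CdL_sum_eq_span: "CdL_sum s = FV.span (\<Union>p. CdL_component s p)"
proof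
  show "FV.span (\<Union>p. CdL_component s p) \<subseteq> CdL_sum s"
  proof (rule FV.span_minimal[OF _ subspace_CdL_sum])
    show "(\<Union>p. CdL_component s p) \<subseteq> CdL_sum s"
    proof clarify
      fix x p assume "x \<in> CdL_component s p"
      then obtain X where X: "X \<in> CdL s p" "x = single p X" by (auto simp: component_iff)
      have "{n. x n \<noteq> 0} \<subseteq> {p}" using X by (auto simp: single_def)
      then have "finite {n. x n \<noteq> 0}" by (rule finite_subset) simp
      then show "x \<in> CdL_sum s" using X by (auto simp: CdL_sum_def single_def CdL_zero)
    qed
  qed
  show "CdL_sum s \<subseteq> FV.span (\<Union>p. CdL_component s p)"
  proof
    fix x assume x: "x \<in> CdL_sum s"
    let ?S = "{p. x p \<noteq> 0}"
    have "x = (\<Sum>p\<in>?S. single p (x p))"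
    proof
      fix n
      have "finite ?S" using x by (simp add: CdL_sum_def)
      then show "x n = (\<Sum>p\<in>?S. single p (x p)) n"
        by (simp add: family_sum_apply single_def)
    qed
    moreover have "(\<Sum>p\<in>?S. single p (x p)) \<in> FV.span (\<Union>p. CdL_component s p)"
      using x by (intro FV.span_sum FV.span_base) (auto simp: component_iff CdL_sum_def)
    ultimately show "x \<in> FV.span (\<Union>p. CdL_component s p)" by simp
  qed
qed

lemma CdL_sum_E: "x \<in> CdL_sum s \<Longrightarrow> x n \<in> E (n + 1)"
  using CdL_E[of "x n" n] by (auto simp: CdL_sum_def)

text \<open>The support of the bracket lies in the sumset of the two supports.\<close>

lemma bracket_sum_in:
  assumes x: "x \<in> CdL_sum s" and y: "y \<in> CdL_sum s"
  shows "bracket_sum s x y \<in> CdL_sum s"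
proof -
  have "bracket_sum s x y n \<in> CdL s n" for n
    unfolding bracket_sum_def
  proof (rule CdL_sum_in)
    fix p assume "p \<in> {0..n}"
    then show "bracket_dL s p (n - p) (x p) (y (n - p)) \<in> CdL s n"
      using bracket_CdL[OF CdL_sum_E[OF x] CdL_sum_E[OF y], of p "n - p"] by simp
  qed
  moreover have "{n. bracket_sum s x y n \<noteq> 0} \<subseteq> (\<lambda>(p, q). p + q) ` ({p. x p \<noteq> 0} \<times> {q. y q \<noteq> 0})"
  proof
    fix n assume "n \<in> {n. bracket_sum s x y n \<noteq> 0}"
    then obtain p where p: "p \<in> {0..n}" "bracket_dL s p (n - p) (x p) (y (n - p)) \<noteq> 0"
      unfolding bracket_sum_def by (auto elim: sum.not_neutral_contains_not_neutral)
    have "x p \<noteq> 0" using p(2) bracket_zero(1)[OF CdL_sum_E[OF y]] by metis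
    moreover have "y (n - p) \<noteq> 0" using p(2) bracket_zero(2)[OF CdL_sum_E[OF x]] by metis
    ultimately show "n \<in> (\<lambda>(p, q). p + q) ` ({p. x p \<noteq> 0} \<times> {q. y q \<noteq> 0})"
      using p(1) by (intro image_eqI[where x = "(p, n - p)"]) auto
  qed
  moreover have "finite ((\<lambda>(p, q). p + q) ` ({p. x p \<noteq> 0} \<times> {q. y q \<noteq> 0}))"
    using x y by (simp add: CdL_sum_def)
  ultimately show ?thesis
    by (auto simp: CdL_sum_def intro: finite_subset)
qed

lemma bracket_sum_single:
  assumes "X \<in> CdL s p" "Y \<in> CdL s q"
  shows "bracket_sum s (single p X) (single q Y) = single (p + q) (bracket_dL s p q X Y)"
proof
  fix n
  have "bracket_dL s i (n - i) (single p X i) (single q Y (n - i))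
      = (if i = p then if n - p = q then bracket_dL s p q X Y else 0 else 0)" for i
    using CdL_E[OF assms(1)] CdL_E[OF assms(2)] E_zero
    by (auto simp: single_def bracket_zero)
  then have "bracket_sum s (single p X) (single q Y) n
      = (if p \<le> n then if n - p = q then bracket_dL s p q X Y else 0 else 0)"
    by (simp add: bracket_sum_def)
  then show "bracket_sum s (single p X) (single q Y) n = single (p + q) (bracket_dL s p q X Y) n"
    by (auto simp: single_def)
qed

lemma single_add: "single p X + single p Y = single p (X + Y)"
  by (auto simp: single_def fun_eq_iff[where 'a = nat] family_pointwise)

lemma single_scale: "family_scale c (single p X) = single p (endo_scale c X)"
  by (auto simp: single_def fun_eq_iff[where 'a = nat] family_pointwise)

lemma single_uminus: "- single p X = single p (- X)"
  by (auto simp: single_def fun_eq_iff[where 'a = nat] family_pointwise)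

lemma bracket_sum_bilinear:
  assumes x: "x \<in> CdL_sum s" and y: "y \<in> CdL_sum s"
  shows "z \<in> CdL_sum s \<Longrightarrow> bracket_sum s (x + y) z = bracket_sum s x z + bracket_sum s y z"
    and "z \<in> CdL_sum s \<Longrightarrow> bracket_sum s z (x + y) = bracket_sum s z x + bracket_sum s z y"
    and "bracket_sum s (family_scale c x) y = family_scale c (bracket_sum s x y)"
    and "bracket_sum s x (family_scale c y) = family_scale c (bracket_sum s x y)"
  using x y CdL_sum_E
  by (auto simp: bracket_sum_def fun_eq_iff[where 'a = nat] family_pointwise bracket_add bracket_scale
      sum.distrib EV.scale_sum_right)

theorem graded_lie_algebra_CdL:
  "graded_lie_algebra family_scale (CdL_sum s) (CdL_component s) (bracket_sum s)"
  unfolding graded_lie_algebra_def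
proof (intro conjI allI ballI impI)
  show "vector_space (family_scale :: 'k \<Rightarrow> ('v, 'k) endo_family \<Rightarrow> _)" by (rule vector_space_family)
  show "FV.subspace (CdL_component s p)" for p by (rule subspace_component)
  show "CdL_sum s = FV.span (\<Union>p. CdL_component s p)" by (rule CdL_sum_eq_span)
  show "x p = 0" if x: "(\<forall>p<N. x p \<in> CdL_component s p) \<and> (\<Sum>p<N. x p) = 0" and p: "p < N" for x N p
  proof
    fix n
    \<comment> \<open>In degree \<open>p\<close> the vanishing sum reduces to \<open>x p p\<close>, and \<open>x p\<close> is zero in the other degrees.\<close>
    have "x p p = (\<Sum>q<N. if q = p then x p p else 0)" using p by simp
    also have "\<dots> = (\<Sum>q<N. x q p)"
      using x by (intro sum.cong) (auto simp: CdL_component_def)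
    also have "\<dots> = (\<Sum>q<N. x q) p" by (simp add: family_sum_apply)
    also have "\<dots> = 0" using x by (simp add: family_pointwise)
    finally show "x p n = 0 n"
      using x p by (cases "n = p") (auto simp: CdL_component_def family_pointwise)
  qed
next
  fix p q r x y z
  assume "x \<in> CdL_component s p" "y \<in> CdL_component s q" "z \<in> CdL_component s r"
  then obtain X Y Z where X: "X \<in> CdL s p" "x = single p X" and Y: "Y \<in> CdL s q" "y = single q Y"
    and Z: "Z \<in> CdL s r" "z = single r Z"
    by (auto simp: component_iff)
  note B = bracket_CdL[OF CdL_E CdL_E]
  show "bracket_sum s x (bracket_sum s y z) = bracket_sum s (bracket_sum s x y) z
      + family_scale ((-1) ^ (p * q)) (bracket_sum s y (bracket_sum s x z))"
    using X Y Z bracket_jacobi[OF X(1) Y(1) Z(1)]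
    by (simp add: bracket_sum_single B single_add single_scale add_ac)
next
  fix p q x y
  assume "x \<in> CdL_component s p" "y \<in> CdL_component s q"
  then obtain X Y where X: "X \<in> CdL s p" "x = single p X" and Y: "Y \<in> CdL s q" "y = single q Y"
    by (auto simp: component_iff)
  show "bracket_sum s x y \<in> CdL_component s (p + q)"
    using X Y bracket_CdL[OF CdL_E CdL_E] by (auto simp: bracket_sum_single component_iff)
  show "bracket_sum s x y = - family_scale ((-1) ^ (p * q)) (bracket_sum s y x)"
    using X Y bracket_antisymmetric[of p q X Y]
    by (simp add: bracket_sum_single single_scale single_uminus add.commute)
qed (auto intro: bracket_sum_in bracket_sum_bilinear)

end

theorem theorem2p6:
  fixes s :: "'k::field_char_0 \<Rightarrow> 'v::ab_group_add \<Rightarrow> 'v" and B :: "'v set"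
  assumes "finite_dimensional_vector_space s B"
  shows "graded_lie_algebra family_scale (CdL_sum s) (CdL_component s) (bracket_sum s) \<and>
    (\<forall>p q P Q. P \<in> CdL s p \<longrightarrow> Q \<in> CdL s q \<longrightarrow>
       bracket_dL s p q P Q = - endo_scale ((-1) ^ (p * q)) (bracket_dL s q p Q P)) \<and>
    (\<forall>p q r P Q R. P \<in> CdL s p \<longrightarrow> Q \<in> CdL s q \<longrightarrow> R \<in> CdL s r \<longrightarrow>
       bracket_dL s p (q + r) P (bracket_dL s q r Q R) =
         bracket_dL s (p + q) r (bracket_dL s p q P Q) R
         + endo_scale ((-1) ^ (p * q)) (bracket_dL s q (p + r) Q (bracket_dL s p r P R)))"
proof -
  interpret finite_dimensional_vector_space s B by fact
  interpret tensor_space s by (rule tensor_space.intro) (rule vector_space_axioms)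
  show ?thesis
    using graded_lie_algebra_CdL bracket_antisymmetric bracket_jacobi by blast
qed

end
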